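(* Let $M=G/H$ be a homogeneous manifold with reductive decomposition $\mathfrak g=\mathfrak h+\mathfrak m$, and let $F=\alpha\,\phi\!\left(\frac{\alpha_2}{\alpha}\right)$ be a $G$-invariant $(\alpha_1,\alpha_2)$-metric on $M$ defined by a $G$-invariant Riemannian metric $g$, $\alpha=\sqrt{g(\cdot,\cdot)}$, with corresponding $\mathrm{Ad}(H)$-invariant $g$-orthogonal decomposition $\mathfrak m=\mathfrak m_1+\mathfrak m_2$, such that $\mathfrak g'=[\mathfrak g,\mathfrak g]\subseteq\mathfrak h+\mathfrak m_1$. Let $X\in\mathfrak g\setminus\{0\}$. (1) If $X$ is a geodesic vector for $(G/H,g)$, then $X$ is a geodesic vector for $(G/H,F)$. (2) Conversely, if $X$ is a geodesic vector for $(G/H,F)$ such that $\phi^2(b)-\phi(b)\phi'(b)\,b\neq0$ and $\phi''(b)\le0$, where $b=\frac{|X_{\mathfrak m_2}|_g}{|X_{\mathfrak m}|_g}$, then $X$ is a geodesic vector for $(G/H,g)$.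
   Context: $G$ is a Lie group with Lie algebra $\mathfrak g$, $H$ a closed subgroup with Lie algebra $\mathfrak h$; a reductive decomposition is an $\mathrm{Ad}(H)$-invariant direct sum decomposition $\mathfrak g=\mathfrak h+\mathfrak m$, and $\mathfrak m$ is identified with $T_o(G/H)$, $o=eH$. A subscript $\mathfrak m$ or $\mathfrak m_i$ denotes the corresponding component of a vector of $\mathfrak g$. $(\alpha_1,\alpha_2)$-metric: a Finsler metric $F$ on $M$ (smooth and strongly convex on $TM\setminus\{0\}$) of the form $F(x,y)=\alpha(x,y)\,\phi\!\left(\frac{\alpha_2(x,y)}{\alpha(x,y)}\right)$, where $\alpha$ is a Riemannian metric (written as a norm), $TM=\mathcal V_1\oplus\mathcal V_2$ is an $\alpha$-orthogonal bundle decomposition, $\alpha_i(x,y)=\alpha(x,y_i)$ for $y=y_1+y_2$ with $y_i\in\mathcal V_i$, and $\phi$ is a positive smooth function on $[0,1]$. In the homogeneous setting $F$, $\alpha$ and the decomposition are $G$-invariant, so they are given by an $\mathrm{Ad}(H)$-invariant inner product $\langle\cdot,\cdot\rangle=g_o$ on $\mathfrak m$ (with norm $|\cdot|_g$) and an $\mathrm{Ad}(H)$-invariant orthogonal decomposition $\mathfrak m=\mathfrak m_1+\mathfrak m_2$. Fundamental tensor: $g_y(u,v)=\frac12\frac{\partial^2}{\partial s\partial t}F^2(y+su+tv)\big|_{s=t=0}$ for $y\neq0$. Geodesic vector: $X\in\mathfrak g\setminus\{0\}$ (with $X_{\mathfrak m}\neq0$) is a geodesic vector for $(G/H,g)$ (respectively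 $(G/H,F)$) if the curve $t\mapsto\exp(tX)\cdot o$ is a geodesic of $(G/H,g)$ (respectively $(G/H,F)$). Equivalently (known criteria): $X$ is a geodesic vector for $(G/H,g)$ iff $\langle X_{\mathfrak m},[X,Y]_{\mathfrak m}\rangle=0$ for all $Y\in\mathfrak m$; $X$ is a geodesic vector for $(G/H,F)$ iff $g_{X_{\mathfrak m}}(X_{\mathfrak m},[X,Z]_{\mathfrak m})=0$ for all $Z\in\mathfrak g$. *)

theory Defs
  imports "HOL-Analysis.Analysis" "HOL-Algebra.Left_Coset"
begin

section \<open>Smooth maps between subsets of Euclidean spaces\<close>

text \<open>
  Derivatives are taken within \<open>S\<close>. For open \<open>S\<close> this is the ordinary notion; for
  \<open>S = {0..1}\<close> the derivatives at the end points are one-sided.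
\<close>

fun Ck_on :: "nat \<Rightarrow> 'a::euclidean_space set \<Rightarrow> ('a \<Rightarrow> 'b::euclidean_space) \<Rightarrow> bool" where
  "Ck_on 0 S f \<longleftrightarrow> continuous_on S f"
| "Ck_on (Suc k) S f \<longleftrightarrow>
     f differentiable_on S \<and> (\<forall>v. Ck_on k S (\<lambda>x. frechet_derivative f (at x within S) v))"

definition smooth_on :: "'a::euclidean_space set \<Rightarrow> ('a \<Rightarrow> 'b::euclidean_space) \<Rightarrow> bool" where
  "smooth_on S f \<longleftrightarrow> (\<forall>k. Ck_on k S f)"

definition deriv01 :: "(real \<Rightarrow> real) \<Rightarrow> real \<Rightarrow> real" where
  "deriv01 \<phi> b = vector_derivative \<phi> (at b within {0..1})"


section \<open>Smooth manifolds\<close>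

type_synonym ('m, 'e) chart = "'m set \<times> ('m \<Rightarrow> 'e)"

definition chart_inv :: "('m, 'e) chart \<Rightarrow> 'e \<Rightarrow> 'm" where
  "chart_inv c = inv_into (fst c) (snd c)"

definition smooth_manifold :: "'m topology \<Rightarrow> ('m, 'e::euclidean_space) chart set \<Rightarrow> bool" where
  "smooth_manifold X A \<longleftrightarrow>
     Hausdorff_space X \<and> second_countable X \<and> \<Union>(fst ` A) = topspace X \<and>
     (\<forall>(U, \<kappa>)\<in>A. openin X U \<and> open (\<kappa> ` U) \<and>
        homeomorphic_map (subtopology X U) (top_of_set (\<kappa> ` U)) \<kappa>) \<and>
     (\<forall>(U, \<kappa>)\<in>A. \<forall>(V, \<eta>)\<in>A. smooth_on (\<kappa> ` (U \<inter> V)) (\<eta> \<circ> chart_inv (U, \<kappa>)))"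

text \<open>The standard atlas of a Euclidean space.\<close>

definition std_atlas :: "('e, 'e::euclidean_space) chart set" where
  "std_atlas = {(UNIV, id)}"

definition prod_atlas ::
  "('m, 'e) chart set \<Rightarrow> ('n, 'f) chart set \<Rightarrow> ('m \<times> 'n, 'e \<times> 'f) chart set" where
  "prod_atlas A B = {(U \<times> V, map_prod \<kappa> \<eta>) | U \<kappa> V \<eta>. (U, \<kappa>) \<in> A \<and> (V, \<eta>) \<in> B}"

definition smooth_map ::
  "'m topology \<Rightarrow> ('m, 'e::euclidean_space) chart set \<Rightarrow>
   'n topology \<Rightarrow> ('n, 'f::euclidean_space) chart set \<Rightarrow> ('m \<Rightarrow> 'n) \<Rightarrow> bool" where
  "smooth_map X A Y B f \<longleftrightarrow>
     continuous_map X Y f \<and>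
     (\<forall>(U, \<kappa>)\<in>A. \<forall>(V, \<eta>)\<in>B.
        smooth_on (\<kappa> ` {p \<in> U. f p \<in> V}) (\<eta> \<circ> f \<circ> chart_inv (U, \<kappa>)))"

text \<open>
  The tangent space at \<open>p\<close> is the model space \<open>'e\<close>, a vector being represented by its
  coordinates in one chart around \<open>p\<close> that is chosen once and for all, namely
  \<open>chart_at A p\<close>. Coordinates in other charts are obtained by the Jacobian of the chart
  transition. The Euclidean structure of \<open>'e\<close> plays no role.
\<close>

definition chart_at :: "('m, 'e) chart set \<Rightarrow> 'm \<Rightarrow> ('m, 'e) chart" where
  "chart_at A p = (SOME c. c \<in> A \<and> p \<in> fst c)"

definition chart_change ::
  "('m, 'e::euclidean_space) chart \<Rightarrow> ('m, 'e) chart \<Rightarrow> 'm \<Rightarrow> 'e \<Rightarrow> 'e" where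
  "chart_change c d p = frechet_derivative (snd d \<circ> chart_inv c) (at (snd c p))"

definition tangent_of_coords ::
  "('m, 'e::euclidean_space) chart set \<Rightarrow> ('m, 'e) chart \<Rightarrow> 'm \<Rightarrow> 'e \<Rightarrow> 'e" where
  "tangent_of_coords A c p = chart_change c (chart_at A p) p"

definition coords_of_tangent ::
  "('m, 'e::euclidean_space) chart set \<Rightarrow> ('m, 'e) chart \<Rightarrow> 'm \<Rightarrow> 'e \<Rightarrow> 'e" where
  "coords_of_tangent A c p = chart_change (chart_at A p) c p"

text \<open>The tangent map of \<open>f\<close> at \<open>p\<close>, from the tangent space at \<open>p\<close> to the one at \<open>f p\<close>.\<close>

definition tangent_map ::
  "('m, 'e::euclidean_space) chart set \<Rightarrow> ('n, 'f::euclidean_space) chart set \<Rightarrow>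
   ('m \<Rightarrow> 'n) \<Rightarrow> 'm \<Rightarrow> 'e \<Rightarrow> 'f" where
  "tangent_map A B f p =
     frechet_derivative (snd (chart_at B (f p)) \<circ> f \<circ> chart_inv (chart_at A p))
       (at (snd (chart_at A p) p))"

definition smooth_curve ::
  "'m topology \<Rightarrow> ('m, 'e::euclidean_space) chart set \<Rightarrow> (real \<Rightarrow> 'm) \<Rightarrow> bool" where
  "smooth_curve X A c \<longleftrightarrow> smooth_map euclideanreal std_atlas X A c"

definition velocity ::
  "('m, 'e::euclidean_space) chart set \<Rightarrow> (real \<Rightarrow> 'm) \<Rightarrow> real \<Rightarrow> 'e" where
  "velocity A c t = vector_derivative (snd (chart_at A (c t)) \<circ> c) (at t)"


section \<open>Direct sums and components\<close>

definition direct_sum :: "'e::real_vector set \<Rightarrow> 'e set \<Rightarrow> 'e set \<Rightarrow> bool" where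
  "direct_sum W P Q \<longleftrightarrow> subspace P \<and> subspace Q \<and> P \<inter> Q = {0} \<and> W = {u + v | u v. u \<in> P \<and> v \<in> Q}"

text \<open>The component in \<open>P\<close> of a vector of the direct sum of \<open>P\<close> and \<open>Q\<close>.\<close>

definition comp_along :: "'e::real_vector set \<Rightarrow> 'e set \<Rightarrow> 'e \<Rightarrow> 'e" where
  "comp_along P Q x = (THE y. y \<in> P \<and> x - y \<in> Q)"


section \<open>Finsler and Riemannian metrics\<close>

text \<open>A function on the tangent bundle, expressed in the coordinates of the chart \<open>c\<close>.\<close>

definition local_rep ::
  "('m, 'e::euclidean_space) chart set \<Rightarrow> ('m, 'e) chart \<Rightarrow> ('m \<Rightarrow> 'e \<Rightarrow> real) \<Rightarrow> 'e \<Rightarrow> 'e \<Rightarrow> real" where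
  "local_rep A c F x v = F (chart_inv c x) (tangent_of_coords A c (chart_inv c x) v)"

text \<open>The fundamental tensor of a Minkowski norm \<open>N\<close> (the restriction of \<open>F\<close> to one tangent space).\<close>

definition fundamental_tensor :: "('e::euclidean_space \<Rightarrow> real) \<Rightarrow> 'e \<Rightarrow> 'e \<Rightarrow> 'e \<Rightarrow> real" where
  "fundamental_tensor N y u v =
     1 / 2 * deriv (\<lambda>s. deriv (\<lambda>t. (N (y + s *\<^sub>R u + t *\<^sub>R v))\<^sup>2) 0) 0"

definition finsler_metric ::
  "'m topology \<Rightarrow> ('m, 'e::euclidean_space) chart set \<Rightarrow> ('m \<Rightarrow> 'e \<Rightarrow> real) \<Rightarrow> bool" where
  "finsler_metric X A F \<longleftrightarrow>
     (\<forall>p\<in>topspace X. F p 0 = 0 \<and> (\<forall>y. y \<noteq> 0 \<longrightarrow> F p y > 0) \<and>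
        (\<forall>r>0. \<forall>y. F p (r *\<^sub>R y) = r * F p y) \<and>
        (\<forall>y u. y \<noteq> 0 \<longrightarrow> u \<noteq> 0 \<longrightarrow> fundamental_tensor (F p) y u u > 0)) \<and>
     (\<forall>(U, \<kappa>)\<in>A. smooth_on (\<kappa> ` U \<times> (- {0})) (\<lambda>(x, v). local_rep A (U, \<kappa>) F x v))"

definition riemannian_metric ::
  "'m topology \<Rightarrow> ('m, 'e::euclidean_space) chart set \<Rightarrow> ('m \<Rightarrow> 'e \<Rightarrow> 'e \<Rightarrow> real) \<Rightarrow> bool" where
  "riemannian_metric X A g \<longleftrightarrow>
     (\<forall>p\<in>topspace X. bilinear (g p) \<and> (\<forall>u v. g p u v = g p v u) \<and> (\<forall>u. u \<noteq> 0 \<longrightarrow> g p u u > 0)) \<and>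
     (\<forall>(U, \<kappa>)\<in>A. \<forall>u v. smooth_on (\<kappa> ` U)
        (\<lambda>x. let p = chart_inv (U, \<kappa>) x
              in g p (tangent_of_coords A (U, \<kappa>) p u) (tangent_of_coords A (U, \<kappa>) p v)))"

definition riem_norm :: "('m \<Rightarrow> 'e \<Rightarrow> 'e \<Rightarrow> real) \<Rightarrow> 'm \<Rightarrow> 'e \<Rightarrow> real" where
  "riem_norm g p y = sqrt (g p y y)"

text \<open>
  A g-orthogonal decomposition of the tangent bundle into two smooth subbundles; smoothness is
  that of the bundle projection to \<open>V1\<close> (hence also of the one to \<open>V2\<close>).
\<close>

definition orthogonal_bundle_decomposition ::
  "'m topology \<Rightarrow> ('m, 'e::euclidean_space) chart set \<Rightarrow> ('m \<Rightarrow> 'e \<Rightarrow> 'e \<Rightarrow> real) \<Rightarrow>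
   ('m \<Rightarrow> 'e set) \<Rightarrow> ('m \<Rightarrow> 'e set) \<Rightarrow> bool" where
  "orthogonal_bundle_decomposition X A g V1 V2 \<longleftrightarrow>
     (\<forall>p\<in>topspace X. direct_sum UNIV (V1 p) (V2 p) \<and> (\<forall>u\<in>V1 p. \<forall>v\<in>V2 p. g p u v = 0)) \<and>
     (\<forall>(U, \<kappa>)\<in>A. \<forall>v. smooth_on (\<kappa> ` U)
        (\<lambda>x. let p = chart_inv (U, \<kappa>) x
              in coords_of_tangent A (U, \<kappa>) p
                   (comp_along (V1 p) (V2 p) (tangent_of_coords A (U, \<kappa>) p v))))"

definition alpha12_metric ::
  "'m topology \<Rightarrow> ('m, 'e::euclidean_space) chart set \<Rightarrow> ('m \<Rightarrow> 'e \<Rightarrow> real) \<Rightarrow>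
   ('m \<Rightarrow> 'e \<Rightarrow> 'e \<Rightarrow> real) \<Rightarrow> ('m \<Rightarrow> 'e set) \<Rightarrow> ('m \<Rightarrow> 'e set) \<Rightarrow> (real \<Rightarrow> real) \<Rightarrow> bool" where
  "alpha12_metric X A F g V1 V2 \<phi> \<longleftrightarrow>
     finsler_metric X A F \<and> riemannian_metric X A g \<and> orthogonal_bundle_decomposition X A g V1 V2 \<and>
     smooth_on {0..1} \<phi> \<and> (\<forall>s\<in>{0..1}. \<phi> s > 0) \<and>
     (\<forall>p\<in>topspace X. \<forall>y. y \<noteq> 0 \<longrightarrow>
        (let \<alpha> = riem_norm g p y;
             \<alpha>2 = riem_norm g p (comp_along (V2 p) (V1 p) y)
         in F p y = \<alpha> * \<phi> (\<alpha>2 / \<alpha>)))"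

text \<open>
  Constant speed geodesics, as the regular curves that in every chart satisfy the geodesic
  equation in Euler--Lagrange form, with the energy \<open>L = F\<^sup>2 / 2\<close> as Lagrangian:
  for all directions \<open>w\<close>, the \<open>t\<close>-derivative of the fibre derivative of \<open>L\<close> in direction \<open>w\<close>
  along \<open>(x, x')\<close> is the base derivative of \<open>L\<close> in direction \<open>w\<close>. With the
  fundamental tensor of \<open>F\<close> this is the spray equation with lowered index; for the norm
  \<open>F = riem_norm g\<close> of a Riemannian metric it is the Levi-Civita geodesic equation.
\<close>

definition chart_energy ::
  "('m, 'e::euclidean_space) chart set \<Rightarrow> ('m, 'e) chart \<Rightarrow> ('m \<Rightarrow> 'e \<Rightarrow> real) \<Rightarrow> 'e \<Rightarrow> 'e \<Rightarrow> real" where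
  "chart_energy A c F x v = 1 / 2 * (local_rep A c F x v)\<^sup>2"

definition geodesic ::
  "'m topology \<Rightarrow> ('m, 'e::euclidean_space) chart set \<Rightarrow> ('m \<Rightarrow> 'e \<Rightarrow> real) \<Rightarrow> (real \<Rightarrow> 'm) \<Rightarrow> bool" where
  "geodesic X A F \<gamma> \<longleftrightarrow>
     smooth_curve X A \<gamma> \<and> (\<forall>t. velocity A \<gamma> t \<noteq> 0) \<and>
     (\<forall>c\<in>A. \<forall>t. \<gamma> t \<in> fst c \<longrightarrow>
        (let x = snd c \<circ> \<gamma>;
             x' = (\<lambda>s. vector_derivative x (at s));
             L = chart_energy A c F
         in \<forall>w. ((\<lambda>s. frechet_derivative (\<lambda>v. L (x s) v) (at (x' s)) w)
                  has_real_derivative frechet_derivative (\<lambda>z. L z (x' t)) (at (x t)) w) (at t)))"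


section \<open>Lie groups\<close>

definition lie_group :: "'g monoid \<Rightarrow> 'g topology \<Rightarrow> ('g, 'e::euclidean_space) chart set \<Rightarrow> bool" where
  "lie_group G X A \<longleftrightarrow>
     group G \<and> topspace X = carrier G \<and> smooth_manifold X A \<and>
     smooth_map (prod_topology X X) (prod_atlas A A) X A (\<lambda>(a, b). a \<otimes>\<^bsub>G\<^esub> b) \<and>
     smooth_map X A X A (\<lambda>a. inv\<^bsub>G\<^esub> a)"

text \<open>
  The Lie algebra is the tangent space at the identity, i.e. the whole type \<open>'e\<close>. The bracket is
  \<open>[Y, Z] = ad Y Z\<close>, where \<open>ad\<close> is the differential of \<open>Ad\<close> at the identity.
\<close>

definition Ad :: "'g monoid \<Rightarrow> ('g, 'e::euclidean_space) chart set \<Rightarrow> 'g \<Rightarrow> 'e \<Rightarrow> 'e" where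
  "Ad G A a = tangent_map A A (\<lambda>b. a \<otimes>\<^bsub>G\<^esub> b \<otimes>\<^bsub>G\<^esub> inv\<^bsub>G\<^esub> a) \<one>\<^bsub>G\<^esub>"

definition lie_bracket :: "'g monoid \<Rightarrow> ('g, 'e::euclidean_space) chart set \<Rightarrow> 'e \<Rightarrow> 'e \<Rightarrow> 'e" where
  "lie_bracket G A Y Z = tangent_map A std_atlas (\<lambda>a. Ad G A a Z) \<one>\<^bsub>G\<^esub> Y"

definition derived_algebra :: "'g monoid \<Rightarrow> ('g, 'e::euclidean_space) chart set \<Rightarrow> 'e set" where
  "derived_algebra G A = span {lie_bracket G A Y Z | Y Z. True}"

text \<open>
  \<open>c\<close> is the curve \<open>t \<mapsto> exp (t Y)\<close>, that is, the (unique) smooth one-parameter subgroup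
  with initial velocity \<open>Y\<close>.
\<close>

definition is_exp_curve ::
  "'g monoid \<Rightarrow> 'g topology \<Rightarrow> ('g, 'e::euclidean_space) chart set \<Rightarrow> 'e \<Rightarrow> (real \<Rightarrow> 'g) \<Rightarrow> bool" where
  "is_exp_curve G X A Y c \<longleftrightarrow>
     smooth_curve X A c \<and> (\<forall>s t. c (s + t) = c s \<otimes>\<^bsub>G\<^esub> c t) \<and> velocity A c 0 = Y"

definition subgroup_lie_algebra ::
  "'g monoid \<Rightarrow> 'g topology \<Rightarrow> ('g, 'e::euclidean_space) chart set \<Rightarrow> 'g set \<Rightarrow> 'e set" where
  "subgroup_lie_algebra G X A H = {Y. \<exists>c. is_exp_curve G X A Y c \<and> (\<forall>t. c t \<in> H)}"


section \<open>Homogeneous manifolds\<close>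

text \<open>
  The manifold structure of \<open>G/H\<close> (the set of left cosets) is the one for which the canonical
  projection is a smooth submersion. The base point \<open>eH\<close> is \<open>H\<close> itself, and an element \<open>a\<close>
  of \<open>G\<close> acts by \<open>S \<mapsto> a <# S\<close>.
\<close>

definition homogeneous_manifold ::
  "'g monoid \<Rightarrow> 'g topology \<Rightarrow> ('g, 'e::euclidean_space) chart set \<Rightarrow> 'g set \<Rightarrow>
   'g set topology \<Rightarrow> ('g set, 'f::euclidean_space) chart set \<Rightarrow> bool" where
  "homogeneous_manifold G X A H Y B \<longleftrightarrow>
     lie_group G X A \<and> subgroup H G \<and> closedin X H \<and>
     smooth_manifold Y B \<and> topspace Y = lcosets\<^bsub>G\<^esub> H \<and>
     smooth_map X A Y B (\<lambda>a. a <#\<^bsub>G\<^esub> H) \<and>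
     (\<forall>a\<in>carrier G. surj (tangent_map A B (\<lambda>a. a <#\<^bsub>G\<^esub> H) a)) \<and>
     smooth_map (prod_topology X Y) (prod_atlas A B) Y B (\<lambda>(a, S). a <#\<^bsub>G\<^esub> S)"

definition dact ::
  "'g monoid \<Rightarrow> ('g set, 'f::euclidean_space) chart set \<Rightarrow> 'g \<Rightarrow> 'g set \<Rightarrow> 'f \<Rightarrow> 'f" where
  "dact G B a = tangent_map B B (\<lambda>S. a <#\<^bsub>G\<^esub> S)"

text \<open>
  The differential at \<open>e\<close> of the projection. Restricted to \<open>\<mm>\<close> it is the
  identification of \<open>\<mm>\<close> with the tangent space of \<open>G/H\<close> at the base point.
\<close>

definition dproj ::
  "'g monoid \<Rightarrow> ('g, 'e::euclidean_space) chart set \<Rightarrow> 'g set \<Rightarrow>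
   ('g set, 'f::euclidean_space) chart set \<Rightarrow> 'e \<Rightarrow> 'f" where
  "dproj G A H B = tangent_map A B (\<lambda>a. a <#\<^bsub>G\<^esub> H) \<one>\<^bsub>G\<^esub>"

definition invariant_finsler ::
  "'g monoid \<Rightarrow> 'g set \<Rightarrow> ('g set, 'f::euclidean_space) chart set \<Rightarrow> ('g set \<Rightarrow> 'f \<Rightarrow> real) \<Rightarrow> bool" where
  "invariant_finsler G H B F \<longleftrightarrow>
     (\<forall>a\<in>carrier G. \<forall>p\<in>lcosets\<^bsub>G\<^esub> H. \<forall>y. F (a <#\<^bsub>G\<^esub> p) (dact G B a p y) = F p y)"

definition invariant_riemannian ::
  "'g monoid \<Rightarrow> 'g set \<Rightarrow> ('g set, 'f::euclidean_space) chart set \<Rightarrow>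
   ('g set \<Rightarrow> 'f \<Rightarrow> 'f \<Rightarrow> real) \<Rightarrow> bool" where
  "invariant_riemannian G H B g \<longleftrightarrow>
     (\<forall>a\<in>carrier G. \<forall>p\<in>lcosets\<^bsub>G\<^esub> H. \<forall>u v.
        g (a <#\<^bsub>G\<^esub> p) (dact G B a p u) (dact G B a p v) = g p u v)"

definition invariant_subbundle ::
  "'g monoid \<Rightarrow> 'g set \<Rightarrow> ('g set, 'f::euclidean_space) chart set \<Rightarrow> ('g set \<Rightarrow> 'f set) \<Rightarrow> bool" where
  "invariant_subbundle G H B V \<longleftrightarrow>
     (\<forall>a\<in>carrier G. \<forall>p\<in>lcosets\<^bsub>G\<^esub> H. dact G B a p ` V p = V (a <#\<^bsub>G\<^esub> p))"

definition Ad_invariant ::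
  "'g monoid \<Rightarrow> ('g, 'e::euclidean_space) chart set \<Rightarrow> 'g set \<Rightarrow> 'e set \<Rightarrow> bool" where
  "Ad_invariant G A H W \<longleftrightarrow> (\<forall>a\<in>H. Ad G A a ` W \<subseteq> W)"

text \<open>\<open>Ad H\<close>-invariance of the Lie algebra of \<open>H\<close> is automatic.\<close>

definition reductive_decomposition ::
  "'g monoid \<Rightarrow> 'g topology \<Rightarrow> ('g, 'e::euclidean_space) chart set \<Rightarrow> 'g set \<Rightarrow> 'e set \<Rightarrow> bool" where
  "reductive_decomposition G X A H \<mm> \<longleftrightarrow>
     direct_sum UNIV (subgroup_lie_algebra G X A H) \<mm> \<and> Ad_invariant G A H \<mm>"

text \<open>
  \<open>Z\<close> is a geodesic vector for \<open>(G/H, F)\<close>; the Riemannian case is \<open>F = riem_norm g\<close>.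
\<close>

definition geodesic_vector ::
  "'g monoid \<Rightarrow> 'g topology \<Rightarrow> ('g, 'e::euclidean_space) chart set \<Rightarrow> 'g set \<Rightarrow>
   'g set topology \<Rightarrow> ('g set, 'f::euclidean_space) chart set \<Rightarrow> 'e set \<Rightarrow>
   ('g set \<Rightarrow> 'f \<Rightarrow> real) \<Rightarrow> 'e \<Rightarrow> bool" where
  "geodesic_vector G X A H Y B \<mm> F Z \<longleftrightarrow>
     Z \<noteq> 0 \<and> comp_along \<mm> (subgroup_lie_algebra G X A H) Z \<noteq> 0 \<and>
     (\<exists>c. is_exp_curve G X A Z c \<and> geodesic Y B F (\<lambda>t. c t <#\<^bsub>G\<^esub> H))"

end

theory Submission
  imports Defs
begin

text \<open>
  Let \<open>\<gamma>(t) = c(t) H\<close> be the orbit of a one-parameter subgroup \<open>c\<close> with velocity \<open>X\<close>, and let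
  \<open>L = N\<^sup>2 / 2\<close> be the energy of an invariant metric \<open>N\<close>. Fundamental vector fields are symmetries
  of \<open>L\<close>, so by Noether's argument the Euler--Lagrange expression of \<open>\<gamma>\<close> at \<open>t\<close>, evaluated on the
  field of \<open>Z\<close>, is the \<open>t\<close>-derivative of the momentum \<open>dL\<^sub>o(X\<^sub>\<mm>)(Ad (c(-t)) Z)\<close>. Hence \<open>\<gamma>\<close> is a
  geodesic iff \<open>X\<^sub>\<mm> \<noteq> 0\<close> and \<open>dL\<^sub>o(X\<^sub>\<mm>)([X, Z]\<^sub>\<mm>) = 0\<close> for all \<open>Z\<close>. Since \<open>[X, Z]\<^sub>\<mm>\<close> lies in
  \<open>\<mm>\<^sub>1\<close>, moving \<open>X\<^sub>\<mm>\<close> in its direction does not change \<open>\<alpha>\<^sub>2\<close>, and therefore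
  \<open>dL\<^sub>o(X\<^sub>\<mm>)([X, Z]\<^sub>\<mm>) = (\<phi>\<^sup>2(b) - \<phi>(b) \<phi>'(b) b) \<langle>X\<^sub>\<mm>, [X, Z]\<^sub>\<mm>\<rangle>\<close> for the energy of \<open>F\<close>.
\<close>

section \<open>Twice differentiable maps and symmetries of Lagrangians\<close>

text \<open>\<open>geodesic\<close> asks for the Euler--Lagrange equation in every chart and every
  direction, whereas the symmetry argument only tests it on fundamental fields. Nothing is lost,
  because \<open>G/H\<close> is a single orbit: the projection is a submersion, so these fields span
  every tangent space. Transporting velocity and test field back to the base point by the isometry
  \<open>c t\<close> turns the momentum into a fixed linear form on a moving vector, and all
  dependence on time sits in \<open>Ad\<close>. Since \<open>Ad\<close> of a group element is onto,
  the test vector can be readjusted at each time, and the resulting condition mentions neither time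
  nor chart. The condition involves the first derivative of the energy. By homogeneity this is the
  fundamental tensor with the base vector in one slot, so the criterion is the usual one although no
  second derivative of \<open>F\<close> has to be computed. The argument interchanges two
  derivatives of the action and differentiates the energy twice, off the zero section. Hence
  \<open>twice_differentiable_on\<close>, whose second derivative is taken in fixed directions, the
  form in which \<open>Ck_on\<close> provides it.\<close>

definition twice_differentiable_on ::
  "('a::real_normed_vector \<Rightarrow> 'b::real_normed_vector) \<Rightarrow> 'a set \<Rightarrow> bool" where
  "twice_differentiable_on f S \<longleftrightarrow>
     (\<forall>x\<in>S. f differentiable at x \<and> (\<forall>v. (\<lambda>y. frechet_derivative f (at y) v) differentiable at x))"

section \<open>Chain rules for \<open>frechet_derivative\<close>\<close>

lemma has_derivative_frechet:
  "f differentiable at x \<Longrightarrow> (f has_derivative frechet_derivative f (at x)) (at x)"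
  by (simp add: frechet_derivative_works)

lemma frechet_derivativeI: "(f has_derivative f') (at x) \<Longrightarrow> frechet_derivative f (at x) = f'"
  using frechet_derivative_at by metis

lemma frechet_derivative_scaleR:
  "f differentiable at x \<Longrightarrow> frechet_derivative f (at x) (r *\<^sub>R v) = r *\<^sub>R frechet_derivative f (at x) v"
  using linear_frechet_derivative linear_cmul by blast

lemma has_derivative_frechet_chain:
  assumes "(f has_derivative f') (at x)" "f x = y" "g differentiable at y"
  shows "((\<lambda>x. g (f x)) has_derivative (\<lambda>h. frechet_derivative g (at y) (f' h))) (at x)"
  using has_derivative_compose[OF assms(1), of g "frechet_derivative g (at y)"] assms(2,3)
  by (simp add: has_derivative_frechet)

lemma has_vector_derivative_frechet_chain:
  assumes "(f has_vector_derivative f') (at t)" "f t = y" "g differentiable at y"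
  shows "((\<lambda>s. g (f s)) has_vector_derivative frechet_derivative g (at y) f') (at t)"
  using has_derivative_frechet_chain[OF assms(1)[unfolded has_vector_derivative_def] assms(2,3)]
  by (simp add: has_vector_derivative_def frechet_derivative_scaleR assms(3))

text \<open>Source of the symmetry of mixed derivatives: the quotient is symmetric in
  \<open>u\<close> and \<open>v\<close>, so its limit can be computed with either vector first. The
  mean value theorem is applied once, in direction \<open>u\<close>; the linear approximation at
  \<open>z\<close> of the derivative in that direction does the rest.\<close>

lemma second_difference_tendsto:
  fixes f :: "'a::real_normed_vector \<Rightarrow> real"
  assumes r: "r > 0" and f: "\<And>y. dist y z < r \<Longrightarrow> f differentiable at y"
    and A: "((\<lambda>y. frechet_derivative f (at y) u) has_derivative A) (at z)"
  shows "((\<lambda>h. (f (z + h *\<^sub>R u + h *\<^sub>R v) - f (z + h *\<^sub>R u) - f (z + h *\<^sub>R v) + f z) / h\<^sup>2) \<longlongrightarrow> A v) (at_right 0)"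
proof (rule tendstoI)
  fix \<epsilon> :: real assume "\<epsilon> > 0"
  \<comment> \<open>\<open>e * h * C\<close> dominates the two approximation errors,
    \<open>e * h * (norm u + norm v)\<close> at the point shifted by \<open>h *\<^sub>R v\<close>
    and \<open>e * h * norm u\<close> at the unshifted one. The summand 1 keeps \<open>C\<close>
    positive, and the 2 in \<open>e\<close> makes the final inequality strict.\<close>
  define C where "C = 2 * norm u + norm v + 1"
  have C: "C > 0" "norm u + norm v < C" unfolding C_def by (smt (verit) norm_ge_zero)+
  define e where "e = \<epsilon> / (2 * C)"
  have e: "e > 0" using \<open>\<epsilon> > 0\<close> C by (simp add: e_def)
  define G where "G y = frechet_derivative f (at y) u" for y
  have bl: "bounded_linear A" using A by (rule has_derivative_bounded_linear)
  interpret A: bounded_linear A by (rule bl)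
  obtain d where d: "d > 0" "\<And>k. norm k < d \<Longrightarrow> \<bar>G (z + k) - G z - A k\<bar> \<le> e * norm k"
  proof -
    from A[unfolded has_derivative_at_alt] e obtain d where "d > 0"
      "\<And>y. norm (y - z) < d \<Longrightarrow> norm (G y - G z - A (y - z)) \<le> e * norm (y - z)"
      unfolding G_def by metis
    from this(2)[of "z + _"] \<open>d > 0\<close> show ?thesis by (intro that[of d]) auto
  qed
  have "\<forall>\<^sub>F h in at_right 0. h < min d r / C \<and> h > (0::real)"
    by (intro eventually_conj eventually_at_right_less)
       (rule eventually_at_right_field[THEN iffD2], use d r C in \<open>auto intro!: exI[of _ "min d r / C"]\<close>)
  then show "\<forall>\<^sub>F h in at_right 0. dist ((f (z + h *\<^sub>R u + h *\<^sub>R v) - f (z + h *\<^sub>R u) - f (z + h *\<^sub>R v) + f z) / h\<^sup>2) (A v) < \<epsilon>"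
  proof eventually_elim
    case (elim h)
    then have h: "h > 0" "h * C < d" "h * C < r" using C by (auto simp: field_simps min_def split: if_splits)
    \<comment> \<open>Both points compared below are covered: \<open>c = h\<close> for the shifted
      one and \<open>c = 0\<close> for the unshifted one, hence the factor
      \<open>c / h\<close>.\<close>
    have small: "norm (s *\<^sub>R u + c *\<^sub>R v) < min d r \<and> norm (s *\<^sub>R u + c *\<^sub>R v) \<le> h * (norm u + c / h * norm v)"
      if "0 \<le> s" "s \<le> h" "0 \<le> c" "c \<le> h" for s c
    proof -
      have "norm (s *\<^sub>R u + c *\<^sub>R v) \<le> s * norm u + c * norm v"
        using that norm_triangle_ineq[of "s *\<^sub>R u" "c *\<^sub>R v"] by simp
      moreover have "s * norm u \<le> h * norm u" "c * norm v \<le> h * norm v" using that by (auto intro: mult_right_mono)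
      moreover have "h * norm u + h * norm v < h * C" using h C(2) by (simp add: distrib_left[symmetric])
      ultimately show ?thesis using h by (auto simp: algebra_simps)
    qed
    \<comment> \<open>First difference in direction \<open>v\<close>; the mean value theorem in
      \<open>s\<close> then leaves a difference of derivatives in direction \<open>u\<close> at two
      points that lie \<open>h *\<^sub>R v\<close> apart.\<close>
    define \<psi> where "\<psi> s = f (z + s *\<^sub>R u + h *\<^sub>R v) - f (z + s *\<^sub>R u)" for s
    have der: "(\<psi> has_real_derivative (G (z + s *\<^sub>R u + h *\<^sub>R v) - G (z + s *\<^sub>R u))) (at s)"
      if "0 \<le> s" "s \<le> h" for s
    proof -
      have "dist (z + s *\<^sub>R u + h *\<^sub>R v) z < r" "dist (z + s *\<^sub>R u) z < r"
        using small[of s h] small[of s 0] that h by (auto simp: dist_norm algebra_simps)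
      note D = this[THEN f]
      have "((\<lambda>s. f (z + s *\<^sub>R u + h *\<^sub>R v)) has_derivative (\<lambda>x. frechet_derivative f (at (z + s *\<^sub>R u + h *\<^sub>R v)) (x *\<^sub>R u))) (at s)"
        by (rule has_derivative_frechet_chain[OF _ _ D(1)]) (auto intro!: derivative_eq_intros)
      moreover have "((\<lambda>s. f (z + s *\<^sub>R u)) has_derivative (\<lambda>x. frechet_derivative f (at (z + s *\<^sub>R u)) (x *\<^sub>R u))) (at s)"
        by (rule has_derivative_frechet_chain[OF _ _ D(2)]) (auto intro!: derivative_eq_intros)
      ultimately show ?thesis
        unfolding \<psi>_def has_field_derivative_def G_def
        by (intro has_derivative_eq_rhs[OF has_derivative_diff])
           (assumption+, simp add: fun_eq_iff frechet_derivative_scaleR[OF D(1)] frechet_derivative_scaleR[OF D(2)] right_diff_distrib mult.commute)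
    qed
    obtain s where s: "0 < s" "s < h" "\<psi> h - \<psi> 0 = (h - 0) * (G (z + s *\<^sub>R u + h *\<^sub>R v) - G (z + s *\<^sub>R u))"
      using MVT2[of 0 h \<psi> "\<lambda>s. G (z + s *\<^sub>R u + h *\<^sub>R v) - G (z + s *\<^sub>R u)"] der h by auto
    have q: "f (z + h *\<^sub>R u + h *\<^sub>R v) - f (z + h *\<^sub>R u) - f (z + h *\<^sub>R v) + f z
        = h * (G (z + s *\<^sub>R u + h *\<^sub>R v) - G (z + s *\<^sub>R u))"
      using s(3) by (simp add: \<psi>_def)
    have "\<bar>G (z + (s *\<^sub>R u + h *\<^sub>R v)) - G z - A (s *\<^sub>R u + h *\<^sub>R v)\<bar> \<le> e * norm (s *\<^sub>R u + h *\<^sub>R v)"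
      using small[of s h] s h by (intro d) auto
    also have "\<dots> \<le> e * (h * (norm u + norm v))"
      using small[of s h] s h e by (intro mult_left_mono) auto
    finally have 1: "\<bar>G (z + (s *\<^sub>R u + h *\<^sub>R v)) - G z - A (s *\<^sub>R u + h *\<^sub>R v)\<bar> \<le> e * (h * (norm u + norm v))" .
    have "\<bar>G (z + s *\<^sub>R u) - G z - A (s *\<^sub>R u)\<bar> \<le> e * norm (s *\<^sub>R u)"
      using small[of s 0] s h by (intro d) auto
    also have "\<dots> \<le> e * (h * norm u)"
      using small[of s 0] s h e by (intro mult_left_mono) auto
    finally have 2: "\<bar>G (z + s *\<^sub>R u) - G z - A (s *\<^sub>R u)\<bar> \<le> e * (h * norm u)" .
    have "\<bar>G (z + s *\<^sub>R u + h *\<^sub>R v) - G (z + s *\<^sub>R u) - h * A v\<bar> \<le> e * (h * (norm u + norm v)) + e * (h * norm u)"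
      using 1 2 by (simp add: A.add A.scaleR add.assoc abs_le_iff)
    also have "\<dots> \<le> e * h * C" using e h unfolding C_def by (simp add: algebra_simps)
    also have "\<dots> < \<epsilon> * h" using C h \<open>\<epsilon> > 0\<close> by (simp add: e_def)
    finally have "\<bar>(G (z + s *\<^sub>R u + h *\<^sub>R v) - G (z + s *\<^sub>R u)) / h - A v\<bar> < \<epsilon>"
      using h by (simp add: abs_less_iff field_simps)
    then show ?case unfolding q using h by (simp add: dist_norm power2_eq_square)
  qed
qed

lemma mixed_derivatives_real:
  fixes f :: "'a::real_normed_vector \<Rightarrow> real"
  assumes S: "open S" "z \<in> S" and f: "twice_differentiable_on f S"
  shows "frechet_derivative (\<lambda>y. frechet_derivative f (at y) u) (at z) v =
         frechet_derivative (\<lambda>y. frechet_derivative f (at y) v) (at z) u"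
proof -
  obtain r where r: "r > 0" "\<And>y. dist y z < r \<Longrightarrow> y \<in> S"
    using S by (auto simp: open_dist)
  have *: "((\<lambda>h. (f (z + h *\<^sub>R u + h *\<^sub>R v) - f (z + h *\<^sub>R u) - f (z + h *\<^sub>R v) + f z) / h\<^sup>2) \<longlongrightarrow>
     frechet_derivative (\<lambda>y. frechet_derivative f (at y) u) (at z) v) (at_right 0)" for u v
    by (rule second_difference_tendsto[OF r(1)])
       (use f r S in \<open>auto simp: twice_differentiable_on_def has_derivative_frechet\<close>)
  have "(\<lambda>h. (f (z + h *\<^sub>R v + h *\<^sub>R u) - f (z + h *\<^sub>R v) - f (z + h *\<^sub>R u) + f z) / h\<^sup>2) =
    (\<lambda>h. (f (z + h *\<^sub>R u + h *\<^sub>R v) - f (z + h *\<^sub>R u) - f (z + h *\<^sub>R v) + f z) / h\<^sup>2)"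
    by (auto intro!: ext arg_cong2[where f="(/)"] simp: add.commute add.left_commute)
  note eq = this
  show ?thesis
    by (rule tendsto_unique[OF trivial_limit_at_right_real *[of u v] *[of v u, unfolded eq]])
qed

lemma frechet_derivative_inner:
  fixes f :: "'a::real_normed_vector \<Rightarrow> 'b::real_inner"
  assumes "f differentiable at x"
  shows "frechet_derivative (\<lambda>y. f y \<bullet> b) (at x) = (\<lambda>v. frechet_derivative f (at x) v \<bullet> b)"
  by (rule frechet_derivativeI) (auto intro!: derivative_eq_intros has_derivative_frechet assms)

lemma differentiable_eventually_cong:
  assumes "f differentiable at x" "\<forall>\<^sub>F y in nhds x. f y = g y"
  shows "g differentiable at x"
    and "frechet_derivative g (at x) = frechet_derivative f (at x)"
proof -
  have "(g has_derivative frechet_derivative f (at x)) (at x)"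
    using has_derivative_frechet[OF assms(1)] assms(2) eventually_nhds_x_imp_x[OF assms(2)]
    by (simp add: has_derivative_transform_eventually eventually_nhds_conv_at)
  then show "g differentiable at x" "frechet_derivative g (at x) = frechet_derivative f (at x)"
    by (auto simp: differentiable_def frechet_derivativeI)
qed

text \<open>The scalar case applies to each coordinate. Openness of \<open>S\<close> allows the
  first derivatives of \<open>f\<close> and of its coordinates to be compared on a neighbourhood
  before differentiating again.\<close>

lemma mixed_derivatives:
  fixes f :: "'a::real_normed_vector \<Rightarrow> 'b::euclidean_space"
  assumes S: "open S" "z \<in> S" and f: "twice_differentiable_on f S"
  shows "frechet_derivative (\<lambda>y. frechet_derivative f (at y) u) (at z) v =
         frechet_derivative (\<lambda>y. frechet_derivative f (at y) v) (at z) u"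
proof (rule euclidean_eqI)
  fix b :: 'b assume "b \<in> Basis"
  have ev: "\<forall>\<^sub>F y in nhds w. y \<in> S" if "w \<in> S" for w
    using S that by (simp add: eventually_nhds_in_open)
  have eq: "\<forall>\<^sub>F y in nhds w. frechet_derivative f (at y) u \<bullet> b = frechet_derivative (\<lambda>y. f y \<bullet> b) (at y) u"
    if "w \<in> S" for w u
    using ev[OF that] by eventually_elim (use f in \<open>simp add: frechet_derivative_inner twice_differentiable_on_def\<close>)
  have D: "(\<lambda>y. frechet_derivative f (at y) u) differentiable at w" if "w \<in> S" for u w
    using f that unfolding twice_differentiable_on_def by blast
  have D': "(\<lambda>y. frechet_derivative f (at y) u \<bullet> b) differentiable at w" if "w \<in> S" for u w
    using D[OF that] by simp
  have tw: "twice_differentiable_on (\<lambda>y. f y \<bullet> b) S"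
    unfolding twice_differentiable_on_def
    using f differentiable_eventually_cong(1)[OF D' eq] by (auto simp: twice_differentiable_on_def)
  have "frechet_derivative (\<lambda>y. frechet_derivative f (at y) u) (at z) v \<bullet> b
     = frechet_derivative (\<lambda>y. frechet_derivative (\<lambda>y. f y \<bullet> b) (at y) u) (at z) v" for u v
    using differentiable_eventually_cong(2)[OF D' eq, OF S(2) S(2)] frechet_derivative_inner[OF D[OF S(2)]] by metis
  then show "frechet_derivative (\<lambda>y. frechet_derivative f (at y) u) (at z) v \<bullet> b =
         frechet_derivative (\<lambda>y. frechet_derivative f (at y) v) (at z) u \<bullet> b"
    using mixed_derivatives_real[OF S tw] by metis
qed

section \<open>Noether's identity in coordinates\<close>

lemma DERIV_eventually_cong:
  assumes "(f has_real_derivative D) (at x)" "\<forall>\<^sub>F y in nhds x. f y = g y"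
  shows "(g has_real_derivative D) (at x)"
  using DERIV_cong_ev[OF refl assms(2) refl] assms(1) by (rule iffD1)

text \<open>Product rule for a moving covector paired with a moving vector. The covectors are known
  to be differentiable on fixed vectors only, so the pairing is expanded in \<open>Basis\<close>;
  linearity of \<open>q\<close> comes from uniqueness of derivatives.\<close>

lemma has_real_derivative_linear_family:
  fixes p :: "real \<Rightarrow> 'a::euclidean_space \<Rightarrow> real"
  assumes lin: "\<forall>\<^sub>F s in nhds t. linear (p s)"
    and p: "\<And>w. ((\<lambda>s. p s w) has_real_derivative q w) (at t)"
    and W: "(W has_vector_derivative W') (at t)"
  shows "linear q" and "((\<lambda>s. p s (W s)) has_real_derivative (q (W t) + p t W')) (at t)"
proof -
  show q: "linear q"
  proof
    show "q (v + w) = q v + q w" for v w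
    proof (rule DERIV_unique)
      have "((\<lambda>s. p s v + p s w) has_real_derivative (q v + q w)) (at t)" by (intro DERIV_add p)
      moreover have "\<forall>\<^sub>F s in nhds t. p s v + p s w = p s (v + w)"
        using lin by eventually_elim (simp add: linear_add)
      ultimately show "((\<lambda>s. p s (v + w)) has_real_derivative (q v + q w)) (at t)"
        by (rule DERIV_eventually_cong)
    qed (rule p)
    show "q (r *\<^sub>R v) = r *\<^sub>R q v" for r v
    proof (rule DERIV_unique)
      have "((\<lambda>s. r * p s v) has_real_derivative (r *\<^sub>R q v)) (at t)" by (auto intro!: DERIV_cmult p)
      moreover have "\<forall>\<^sub>F s in nhds t. r * p s v = p s (r *\<^sub>R v)"
        using lin by eventually_elim (simp add: linear_cmul)
      ultimately show "((\<lambda>s. p s (r *\<^sub>R v)) has_real_derivative (r *\<^sub>R q v)) (at t)"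
        by (rule DERIV_eventually_cong)
    qed (rule p)
  qed
  have pt: "linear (p t)" using lin by (rule eventually_nhds_x_imp_x)
  have exp: "f w = (\<Sum>b\<in>Basis. (w \<bullet> b) * f b)" if "linear f" for f :: "'a \<Rightarrow> real" and w
    using linear_sum[OF that, of "\<lambda>b. (w \<bullet> b) *\<^sub>R b" Basis] by (simp add: linear_cmul[OF that] euclidean_representation)
  have Wb: "((\<lambda>s. W s \<bullet> b) has_real_derivative (W' \<bullet> b)) (at t)" for b
    using bounded_linear.has_vector_derivative[OF bounded_linear_inner_left W]
    by (simp add: has_real_derivative_iff_has_vector_derivative)
  have "((\<lambda>s. \<Sum>b\<in>Basis. (W s \<bullet> b) * p s b) has_real_derivative (\<Sum>b\<in>Basis. (W' \<bullet> b) * p t b + q b * (W t \<bullet> b))) (at t)"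
    by (intro DERIV_sum DERIV_mult Wb p)
  also have "(\<Sum>b\<in>Basis. (W' \<bullet> b) * p t b + q b * (W t \<bullet> b)) = q (W t) + p t W'"
    by (simp add: sum.distrib exp[OF q, of "W t"] exp[OF pt, of W'] mult.commute)
  finally have "((\<lambda>s. \<Sum>b\<in>Basis. (W s \<bullet> b) * p s b) has_real_derivative (q (W t) + p t W')) (at t)" .
  moreover have "\<forall>\<^sub>F s in nhds t. (\<Sum>b\<in>Basis. (W s \<bullet> b) * p s b) = p s (W s)"
    using lin by eventually_elim (rule exp[symmetric])
  ultimately show "((\<lambda>s. p s (W s)) has_real_derivative (q (W t) + p t W')) (at t)"
    by (rule DERIV_eventually_cong)
qed

text \<open>\<open>\<Phi>\<close> is a local action in coordinates with identity parameter
  \<open>e0\<close>, its derivative in direction \<open>(Z, 0)\<close> is the fundamental field of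
  \<open>Z\<close>, and \<open>q w\<close> minus the base derivative of \<open>L\<close> is the
  Euler--Lagrange defect in direction \<open>w\<close>. Along any curve with an acceleration at
  \<open>t\<close>, the momentum on the field changes at the rate of the defect on the field. Indeed
  the product rule adds the fibre derivative of \<open>L\<close> on the derivative of the field
  along the curve, and differentiating the invariance of \<open>L\<close> in \<open>e\<close>
  identifies this term with minus the base derivative of \<open>L\<close> on the field.\<close>

lemma euler_lagrange_symmetry:
  fixes L :: "'f::euclidean_space \<times> 'f \<Rightarrow> real" and \<Phi> :: "'e::euclidean_space \<times> 'f \<Rightarrow> 'f"
  assumes S: "open S" "(x t, x' t) \<in> S" and L: "twice_differentiable_on L S"
    and T: "open T" "(e0, x t) \<in> T" and \<Phi>: "twice_differentiable_on \<Phi> T"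
    and x: "(x has_vector_derivative x' t) (at t)" and x': "(x' has_vector_derivative a) (at t)"
    and inv: "\<forall>\<^sub>F e in nhds e0. L (\<Phi> (e, x t), frechet_derivative \<Phi> (at (e, x t)) (0, x' t)) = L (x t, x' t)"
    and id: "\<forall>\<^sub>F y in nhds (x t). \<Phi> (e0, y) = y"
  shows "\<exists>q. linear q \<and> (\<forall>w. ((\<lambda>s. frechet_derivative L (at (x s, x' s)) (0, w)) has_real_derivative q w) (at t)) \<and>
    (\<forall>Z. ((\<lambda>s. frechet_derivative L (at (x s, x' s)) (0, frechet_derivative \<Phi> (at (e0, x s)) (Z, 0)))
       has_real_derivative
         (q (frechet_derivative \<Phi> (at (e0, x t)) (Z, 0))
          - frechet_derivative L (at (x t, x' t)) (frechet_derivative \<Phi> (at (e0, x t)) (Z, 0), 0))) (at t))"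
proof -
  define z where "z s = (x s, x' s)" for s
  have z: "(z has_vector_derivative (x' t, a)) (at t)"
    unfolding z_def by (rule has_vector_derivative_Pair[OF x x'])
  have zS: "\<forall>\<^sub>F s in nhds t. z s \<in> S"
  proof -
    have "isCont z t" using z has_vector_derivative_continuous by blast
    then have "(z \<longlongrightarrow> z t) (nhds t)" by (simp add: isCont_def tendsto_at_iff_tendsto_nhds)
    then show ?thesis using S topological_tendstoD by (fastforce simp: z_def)
  qed
  define p where "p s w = frechet_derivative L (at (z s)) (0, w)" for s w
  define q where "q w = frechet_derivative (\<lambda>y. frechet_derivative L (at y) (0, w)) (at (z t)) (x' t, a)" for w
  have Ld: "L differentiable at y" "(\<lambda>y. frechet_derivative L (at y) v) differentiable at y" if "y \<in> S" for y v
    using L that unfolding twice_differentiable_on_def by blast+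
  have \<Phi>d: "\<Phi> differentiable at y" "(\<lambda>y. frechet_derivative \<Phi> (at y) v) differentiable at y" if "y \<in> T" for y v
    using \<Phi> that unfolding twice_differentiable_on_def by blast+
  have ztS: "z t \<in> S" using S by (simp add: z_def)
  have p: "((\<lambda>s. p s w) has_real_derivative q w) (at t)" for w
  proof -
    have "((\<lambda>s. frechet_derivative L (at (z s)) (0, w)) has_vector_derivative q w) (at t)"
      unfolding q_def by (rule has_vector_derivative_frechet_chain[OF z refl Ld(2)[OF ztS]])
    then show ?thesis by (simp add: p_def has_real_derivative_iff_has_vector_derivative)
  qed
  have linp: "\<forall>\<^sub>F s in nhds t. linear (p s)"
    using zS
  proof eventually_elim
    case (elim s)
    have "linear (\<lambda>w. (0::'f, w::'f))" by (auto intro!: linearI)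
    then show ?case
      using linear_compose[OF _ linear_frechet_derivative[OF Ld(1)[OF elim]], of "\<lambda>w. (0,w)"]
      by (simp add: p_def[abs_def] o_def)
  qed
  define W where "W Z s = frechet_derivative \<Phi> (at (e0, x s)) (Z, 0)" for Z s
  have "((\<lambda>s. p s (W Z s)) has_real_derivative (q (W Z t) - frechet_derivative L (at (z t)) (W Z t, 0))) (at t)" for Z
  proof -
    define M where "M = frechet_derivative (\<lambda>y. frechet_derivative \<Phi> (at y) (Z, 0)) (at (e0, x t)) (0, x' t)"
    have "((\<lambda>s. (e0, x s)) has_vector_derivative (0, x' t)) (at t)"
      by (intro has_vector_derivative_Pair x has_vector_derivative_const)
    from has_vector_derivative_frechet_chain[OF this refl \<Phi>d(2)[OF T(2)]]
    have W: "(W Z has_vector_derivative M) (at t)"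
      unfolding W_def[abs_def] M_def .
    \<comment> \<open>The change of the field along the curve equals the change in \<open>e\<close>
      of the transported velocity: the two derivatives of \<open>\<Phi>\<close> are
      interchanged.\<close>
    have M2: "M = frechet_derivative (\<lambda>y. frechet_derivative \<Phi> (at y) (0, x' t)) (at (e0, x t)) (Z, 0)"
      unfolding M_def by (rule mixed_derivatives[OF T \<Phi>])
    have "frechet_derivative (\<lambda>y. \<Phi> (e0, y)) (at (x t)) = (\<lambda>v. frechet_derivative \<Phi> (at (e0, x t)) (0, v))"
      by (rule frechet_derivativeI, rule has_derivative_frechet_chain[where g=\<Phi>, OF _ _ \<Phi>d(1)[OF T(2)]])
         (auto intro!: derivative_eq_intros)
    moreover have "frechet_derivative (\<lambda>y. \<Phi> (e0, y)) (at (x t)) = (\<lambda>v. v)"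
      using differentiable_eventually_cong(2)[OF differentiable_ident, of "\<lambda>y. \<Phi> (e0, y)" "x t"] id
      by (simp add: eq_commute)
    \<comment> \<open>As \<open>\<Phi> (e0, _)\<close> is the identity near \<open>x t\<close>, the
      transported velocity at \<open>e0\<close> is \<open>x' t\<close> itself, so the invariance is
      differentiated at the point \<open>z t\<close> of the curve.\<close>
    ultimately have idv: "frechet_derivative \<Phi> (at (e0, x t)) (0, x' t) = x' t" by metis
    define u where "u e = (\<Phi> (e, x t), frechet_derivative \<Phi> (at (e, x t)) (0, x' t))" for e
    have ut: "u e0 = z t" using idv eventually_nhds_x_imp_x[OF id] by (simp add: u_def z_def)
    have "((\<lambda>e. (e, x t)) has_derivative (\<lambda>h. (h, 0))) (at e0)" by (auto intro!: derivative_eq_intros)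
    note c = has_derivative_frechet_chain[OF this refl]
    have u: "(u has_derivative (\<lambda>h. (frechet_derivative \<Phi> (at (e0, x t)) (h, 0),
       frechet_derivative (\<lambda>y. frechet_derivative \<Phi> (at y) (0, x' t)) (at (e0, x t)) (h, 0)))) (at e0)"
      unfolding u_def[abs_def] by (intro has_derivative_Pair c \<Phi>d T)
    have "((\<lambda>e. L (u e)) has_derivative (\<lambda>h. frechet_derivative L (at (z t)) (frechet_derivative \<Phi> (at (e0, x t)) (h, 0),
       frechet_derivative (\<lambda>y. frechet_derivative \<Phi> (at y) (0, x' t)) (at (e0, x t)) (h, 0)))) (at e0)"
      by (rule has_derivative_frechet_chain[OF u ut Ld(1)[OF ztS]])
    from frechet_derivativeI[OF this]
    have "frechet_derivative (\<lambda>e. L (u e)) (at e0) Z = frechet_derivative L (at (z t)) (W Z t, M)"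
      by (simp add: W_def M2)
    moreover have "frechet_derivative (\<lambda>e. L (u e)) (at e0) = (\<lambda>h. 0)"
      using differentiable_eventually_cong(2)[where f="\<lambda>_. L (z t)" and g="\<lambda>e. L (u e)" and x=e0] inv
      by (simp add: eq_commute u_def z_def)
    ultimately have "frechet_derivative L (at (z t)) (W Z t, M) = 0" by metis
    then have "p t M = - frechet_derivative L (at (z t)) (W Z t, 0)"
      using linear_add[OF linear_frechet_derivative[OF Ld(1)[OF ztS]], of "(W Z t, 0)" "(0, M)"] by (simp add: p_def)
    then show ?thesis using has_real_derivative_linear_family(2)[OF linp p W] by simp
  qed
  moreover have "linear q" by (rule has_real_derivative_linear_family(1)[OF linp p has_vector_derivative_const])
  ultimately show ?thesis using p unfolding p_def W_def z_def by blast
qed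

section \<open>Closure properties of twice differentiability\<close>

lemma twice_differentiable_onD:
  assumes "twice_differentiable_on f S" "x \<in> S"
  shows "f differentiable at x" "(\<lambda>y. frechet_derivative f (at y) v) differentiable at x"
  using assms unfolding twice_differentiable_on_def by blast+

lemma twice_differentiable_on_cong:
  assumes S: "open S" and f: "twice_differentiable_on f S" and fg: "\<And>x. x \<in> S \<Longrightarrow> f x = g x"
  shows "twice_differentiable_on g S"
  unfolding twice_differentiable_on_def
proof (intro ballI conjI allI)
  have ev: "\<forall>\<^sub>F y in nhds x. y \<in> S" if "x \<in> S" for x using S that by (simp add: eventually_nhds_in_open)
  have eq: "\<forall>\<^sub>F y in nhds x. f y = g y" if "x \<in> S" for x
    using ev[OF that] by eventually_elim (rule fg)
  note 1 = differentiable_eventually_cong[OF twice_differentiable_onD(1)[OF f] eq]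
  fix x v assume x: "x \<in> S"
  show "g differentiable at x" using 1(1)[OF x x] .
  have "\<forall>\<^sub>F y in nhds x. frechet_derivative f (at y) v = frechet_derivative g (at y) v"
    using ev[OF x] by eventually_elim (simp add: 1)
  then show "(\<lambda>y. frechet_derivative g (at y) v) differentiable at x"
    by (rule differentiable_eventually_cong(1)[OF twice_differentiable_onD(2)[OF f x]])
qed

lemma twice_differentiable_onI:
  assumes S: "open S" and f: "\<And>x. x \<in> S \<Longrightarrow> (f has_derivative f' x) (at x)"
    and f': "\<And>x v. x \<in> S \<Longrightarrow> (\<lambda>y. f' y v) differentiable at x"
  shows "twice_differentiable_on f S"
  unfolding twice_differentiable_on_def
proof (intro ballI conjI allI)
  fix x v assume x: "x \<in> S"
  show "f differentiable at x" using f[OF x] by (auto simp: differentiable_def)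
  have "\<forall>\<^sub>F y in nhds x. y \<in> S" using S x by (simp add: eventually_nhds_in_open)
  then have "\<forall>\<^sub>F y in nhds x. f' y v = frechet_derivative f (at y) v"
    by eventually_elim (simp add: frechet_derivativeI[OF f])
  then show "(\<lambda>y. frechet_derivative f (at y) v) differentiable at x"
    by (rule differentiable_eventually_cong(1)[OF f'[OF x]])
qed

lemma twice_differentiable_on_mult:
  fixes f g :: "'a::real_normed_vector \<Rightarrow> real"
  assumes S: "open S" and f: "twice_differentiable_on f S" and g: "twice_differentiable_on g S"
  shows "twice_differentiable_on (\<lambda>x. f x * g x) S"
proof (rule twice_differentiable_onI[OF S])
  note D = twice_differentiable_onD[OF f] twice_differentiable_onD[OF g]
  show "((\<lambda>x. f x * g x) has_derivative
      (\<lambda>v. f x * frechet_derivative g (at x) v + frechet_derivative f (at x) v * g x)) (at x)" if "x \<in> S" for x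
    by (intro has_derivative_mult has_derivative_frechet D that)
  show "(\<lambda>y. f y * frechet_derivative g (at y) v + frechet_derivative f (at y) v * g y) differentiable at x"
    if "x \<in> S" for x v
    by (intro differentiable_add differentiable_mult D that)
qed

lemma twice_differentiable_on_sum:
  fixes f :: "'i \<Rightarrow> 'a::real_normed_vector \<Rightarrow> 'b::real_normed_vector"
  assumes S: "open S" and I: "finite I" and f: "\<And>i. i \<in> I \<Longrightarrow> twice_differentiable_on (f i) S"
  shows "twice_differentiable_on (\<lambda>x. \<Sum>i\<in>I. f i x) S"
proof (rule twice_differentiable_onI[OF S])
  note D = twice_differentiable_onD[OF f]
  show "((\<lambda>x. \<Sum>i\<in>I. f i x) has_derivative (\<lambda>v. \<Sum>i\<in>I. frechet_derivative (f i) (at x) v)) (at x)" if "x \<in> S" for x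
    by (intro has_derivative_sum has_derivative_frechet D that)
  show "(\<lambda>y. \<Sum>i\<in>I. frechet_derivative (f i) (at y) v) differentiable at x" if "x \<in> S" for x v
    using I by (intro differentiable_sum D that ballI)
qed

lemma twice_differentiable_on_compose_linear:
  assumes S: "open S" "open T" and h: "bounded_linear h" "h ` T \<subseteq> S" and f: "twice_differentiable_on f S"
  shows "twice_differentiable_on (\<lambda>x. f (h x)) T"
proof (rule twice_differentiable_onI[OF S(2)])
  note D = twice_differentiable_onD[OF f]
  have hd: "(h has_derivative h) (at x)" for x using h(1) by (rule bounded_linear_imp_has_derivative)
  show "((\<lambda>x. f (h x)) has_derivative (\<lambda>v. frechet_derivative f (at (h x)) (h v))) (at x)" if "x \<in> T" for x
    using h(2) that by (intro has_derivative_frechet_chain[OF hd refl D(1)]) auto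
  show "(\<lambda>y. frechet_derivative f (at (h y)) (h v)) differentiable at x" if "x \<in> T" for x v
    using has_derivative_frechet_chain[OF hd refl D(2)] h(2) that unfolding differentiable_def by blast
qed

lemma twice_differentiable_on_linear:
  assumes "bounded_linear h" "open S"
  shows "twice_differentiable_on h S"
  by (rule twice_differentiable_onI[OF assms(2), of _ "\<lambda>_. h"])
     (auto intro: bounded_linear_imp_has_derivative assms)

text \<open>Two levels of \<open>Ck_on\<close> suffice: on an open set its derivatives within
  \<open>S\<close> are the derivatives at the point.\<close>

lemma smooth_on_imp_twice_differentiable_on:
  assumes "smooth_on S f" "open S"
  shows "twice_differentiable_on f S"
proof (rule twice_differentiable_onI[OF assms(2)])
  have C: "Ck_on (Suc (Suc 0)) S f" using assms by (simp add: smooth_on_def)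
  fix x assume x: "x \<in> S"
  show "(f has_derivative frechet_derivative f (at x within S)) (at x)"
    using C x assms(2) by (simp add: differentiable_on_def at_within_open[OF _ assms(2)] has_derivative_frechet)
  show "(\<lambda>y. frechet_derivative f (at y within S) v) differentiable at x" for v
  proof -
    have "(\<lambda>y. frechet_derivative f (at y within S) v) differentiable (at x within S)"
      using C x by (simp add: differentiable_on_def)
    then show ?thesis by (simp only: at_within_open[OF x assms(2)])
  qed
qed

lemma twice_differentiable_on_const: "open S \<Longrightarrow> twice_differentiable_on (\<lambda>_. a) S"
  by (rule twice_differentiable_onI[where f'="\<lambda>_ _. 0"]) auto

text \<open>For a derivative at a moving point applied to a moving vector, as in the formula for
  \<open>Ad\<close>. Differentiability is known on fixed vectors, to which the expansion in
  \<open>Basis\<close> reduces.\<close>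

lemma differentiable_linear_family:
  fixes P :: "'a::real_normed_vector \<Rightarrow> 'b::euclidean_space \<Rightarrow> 'c::real_normed_vector"
  assumes lin: "\<forall>\<^sub>F x in nhds z. linear (P x)" and P: "\<And>b. (\<lambda>x. P x b) differentiable at z" and V: "V differentiable at z"
  shows "(\<lambda>x. P x (V x)) differentiable at z"
proof (rule differentiable_eventually_cong(1))
  show "(\<lambda>x. \<Sum>b\<in>Basis. (V x \<bullet> b) *\<^sub>R P x b) differentiable at z"
    by (intro differentiable_sum finite_Basis ballI differentiable_scaleR P) (simp_all add: V)
  show "\<forall>\<^sub>F x in nhds z. (\<Sum>b\<in>Basis. (V x \<bullet> b) *\<^sub>R P x b) = P x (V x)"
    using lin
  proof eventually_elim
    case (elim x)
    have "P x (\<Sum>b\<in>Basis. (V x \<bullet> b) *\<^sub>R b) = (\<Sum>b\<in>Basis. (V x \<bullet> b) *\<^sub>R P x b)"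
      by (simp add: linear_sum[OF elim] linear_cmul[OF elim])
    then show ?case by (simp add: euclidean_representation)
  qed
qed

lemma differentiable_frechet_chain:
  "f differentiable at x \<Longrightarrow> g differentiable at (f x) \<Longrightarrow> (\<lambda>x. g (f x)) differentiable at x"
  using has_derivative_frechet_chain[OF has_derivative_frechet refl] unfolding differentiable_def by blast

text \<open>Passes between the separate fibre and base derivatives in \<open>geodesic\<close> and
  the joint derivative used in \<open>euler_lagrange_symmetry\<close>.\<close>

lemma partial_frechet:
  assumes "f differentiable at (x, y)"
  shows "frechet_derivative (\<lambda>v. f (x, v)) (at y) w = frechet_derivative f (at (x, y)) (0, w)"
    and "frechet_derivative (\<lambda>z. f (z, y)) (at x) u = frechet_derivative f (at (x, y)) (u, 0)"
proof -
  have "((\<lambda>v. f (x, v)) has_derivative (\<lambda>w. frechet_derivative f (at (x, y)) (0, w))) (at y)"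
    by (rule has_derivative_frechet_chain[OF _ _ assms]) (auto intro!: derivative_eq_intros)
  then show "frechet_derivative (\<lambda>v. f (x, v)) (at y) w = frechet_derivative f (at (x, y)) (0, w)"
    by (simp add: frechet_derivativeI)
  have "((\<lambda>z. f (z, y)) has_derivative (\<lambda>u. frechet_derivative f (at (x, y)) (u, 0))) (at x)"
    by (rule has_derivative_frechet_chain[OF _ _ assms]) (auto intro!: derivative_eq_intros)
  then show "frechet_derivative (\<lambda>z. f (z, y)) (at x) u = frechet_derivative f (at (x, y)) (u, 0)"
    by (simp add: frechet_derivativeI)
qed


section \<open>Differentials in coordinates\<close>

text \<open>The eventuality is what continuity of \<open>f\<close> contributes: near
  \<open>p\<close> the values stay in the domain of \<open>d\<close>, so \<open>chart_inv d\<close>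
  undoes \<open>snd d\<close> in a composition.\<close>

definition coord_diff_at ::
  "('m, 'e::euclidean_space) chart \<Rightarrow> ('n, 'f::euclidean_space) chart \<Rightarrow> ('m \<Rightarrow> 'n) \<Rightarrow> 'm \<Rightarrow> bool" where
  "coord_diff_at c d f p \<longleftrightarrow> (\<forall>\<^sub>F x in nhds (snd c p). f (chart_inv c x) \<in> fst d) \<and>
     (snd d \<circ> f \<circ> chart_inv c) differentiable at (snd c p)"

text \<open>Both \<open>tangent_map\<close> and \<open>chart_change\<close> are instances, the
  latter with \<open>f = id\<close>, so one chain rule serves tangent maps and changes of
  coordinates alike.\<close>

definition coord_deriv ::
  "('m, 'e::euclidean_space) chart \<Rightarrow> ('n, 'f::euclidean_space) chart \<Rightarrow> ('m \<Rightarrow> 'n) \<Rightarrow> 'm \<Rightarrow> 'e \<Rightarrow> 'f" where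
  "coord_deriv c d f p = frechet_derivative (snd d \<circ> f \<circ> chart_inv c) (at (snd c p))"

text \<open>Only the topological requirements on charts, so that it can be checked directly for
  \<open>std_atlas\<close> and \<open>prod_atlas\<close>.\<close>

definition proper_atlas :: "'m topology \<Rightarrow> ('m, 'e::euclidean_space) chart set \<Rightarrow> bool" where
  "proper_atlas X A \<longleftrightarrow> \<Union>(fst ` A) = topspace X \<and>
     (\<forall>c\<in>A. openin X (fst c) \<and> open (snd c ` fst c) \<and> inj_on (snd c) (fst c) \<and>
        continuous_map (top_of_set (snd c ` fst c)) X (chart_inv c))"

lemma chart_inv_chart: "inj_on (snd c) (fst c) \<Longrightarrow> p \<in> fst c \<Longrightarrow> chart_inv c (snd c p) = p"
  by (simp add: chart_inv_def inv_into_f_f)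

lemma chart_chart_inv: "x \<in> snd c ` fst c \<Longrightarrow> snd c (chart_inv c x) = x \<and> chart_inv c x \<in> fst c"
  by (simp add: chart_inv_def f_inv_into_f inv_into_into)

lemma smooth_manifold_proper:
  assumes "smooth_manifold X A" shows "proper_atlas X A"
  unfolding proper_atlas_def
proof (intro conjI ballI)
  show "\<Union>(fst ` A) = topspace X" using assms by (simp add: smooth_manifold_def)
  fix c assume c: "c \<in> A"
  obtain U \<kappa> where c': "c = (U, \<kappa>)" by (cases c)
  have *: "openin X U" "open (\<kappa> ` U)" "homeomorphic_map (subtopology X U) (top_of_set (\<kappa> ` U)) \<kappa>"
    using assms c unfolding c' smooth_manifold_def by blast+
  have U: "topspace (subtopology X U) = U" using openin_subset[OF *(1)] by auto
  have inj: "inj_on \<kappa> U" using homeomorphic_imp_injective_map[OF *(3)] U by simp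
  show "openin X (fst c)" "open (snd c ` fst c)" "inj_on (snd c) (fst c)" using * inj by (auto simp: c')
  obtain h where h: "homeomorphic_maps (subtopology X U) (top_of_set (\<kappa> ` U)) \<kappa> h"
    using *(3) by (auto simp: homeomorphic_map_maps)
  then have "continuous_map (top_of_set (\<kappa> ` U)) X h" "\<And>x. x \<in> U \<Longrightarrow> h (\<kappa> x) = x"
    using U by (auto simp: homeomorphic_maps_def continuous_map_in_subtopology)
  moreover from this have "h y = chart_inv c y" if "y \<in> \<kappa> ` U" for y
    using that inj by (auto simp: chart_inv_def c')
  ultimately show "continuous_map (top_of_set (snd c ` fst c)) X (chart_inv c)"
    by (auto simp: c' intro: continuous_map_eq)
qed

lemma proper_std_atlas: "proper_atlas euclidean (std_atlas :: ('e, 'e::euclidean_space) chart set)"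
  by (simp add: proper_atlas_def std_atlas_def chart_inv_def inv_id id_def[symmetric])

lemma chart_inv_prod:
  assumes "inj_on (snd c) (fst c)" "inj_on (snd d) (fst d)" "x \<in> snd c ` fst c" "y \<in> snd d ` fst d"
  shows "chart_inv (fst c \<times> fst d, map_prod (snd c) (snd d)) (x, y) = (chart_inv c x, chart_inv d y)"
proof -
  have "inj_on (map_prod (snd c) (snd d)) (fst c \<times> fst d)" using assms by (auto simp: inj_on_def)
  then show ?thesis
    using inv_into_f_f[of "map_prod (snd c) (snd d)" "fst c \<times> fst d" "(chart_inv c x, chart_inv d y)"]
      chart_chart_inv[OF assms(3)] chart_chart_inv[OF assms(4)]
    by (simp add: chart_inv_def[of "(_ \<times> _, _)"])
qed

lemma prod_atlasI: "c \<in> A \<Longrightarrow> d \<in> B \<Longrightarrow> (fst c \<times> fst d, map_prod (snd c) (snd d)) \<in> prod_atlas A B"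
  unfolding prod_atlas_def by (cases c, cases d) force

lemma prod_atlasE:
  assumes "e \<in> prod_atlas A B"
  obtains c d where "c \<in> A" "d \<in> B" "e = (fst c \<times> fst d, map_prod (snd c) (snd d))"
  using assms unfolding prod_atlas_def by force

lemma proper_prod_atlas:
  assumes "proper_atlas X A" "proper_atlas Y B"
  shows "proper_atlas (prod_topology X Y) (prod_atlas A B)"
  unfolding proper_atlas_def
proof (intro conjI ballI)
  show "\<Union>(fst ` prod_atlas A B) = topspace (prod_topology X Y)"
  proof -
    have "\<Union>(fst ` prod_atlas A B) \<subseteq> \<Union>(fst ` A) \<times> \<Union>(fst ` B)"
      by (force elim!: prod_atlasE)
    moreover have *: "(p, q) \<in> \<Union>(fst ` prod_atlas A B)" if "c \<in> A" "p \<in> fst c" "d \<in> B" "q \<in> fst d" for p q c d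
      using UN_I[OF prod_atlasI[OF that(1,3)], of "(p, q)" fst] that by simp
    have "\<Union>(fst ` A) \<times> \<Union>(fst ` B) \<subseteq> \<Union>(fst ` prod_atlas A B)"
      by (rule subsetI, elim SigmaE UN_E) (simp only:, rule *)
    ultimately have eq: "\<Union>(fst ` prod_atlas A B) = \<Union>(fst ` A) \<times> \<Union>(fst ` B)" by (rule subset_antisym)
    show ?thesis using assms unfolding eq proper_atlas_def topspace_prod_topology by (elim conjE) (simp only:)
  qed
  fix e assume "e \<in> prod_atlas A B"
  then obtain c d where cd: "c \<in> A" "d \<in> B" and e: "e = (fst c \<times> fst d, map_prod (snd c) (snd d))" by (rule prod_atlasE)
  have c: "openin X (fst c)" "open (snd c ` fst c)" "inj_on (snd c) (fst c)" "continuous_map (top_of_set (snd c ` fst c)) X (chart_inv c)"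
   and d: "openin Y (fst d)" "open (snd d ` fst d)" "inj_on (snd d) (fst d)" "continuous_map (top_of_set (snd d ` fst d)) Y (chart_inv d)"
    using assms cd by (auto simp: proper_atlas_def)
  have im: "snd e ` fst e = snd c ` fst c \<times> snd d ` fst d" by (simp add: e map_prod_surj_on[OF refl refl])
  show "openin (prod_topology X Y) (fst e)" using c d by (simp add: e openin_prod_Times_iff)
  show "open (snd e ` fst e)" unfolding im using c d by (simp add: open_Times)
  show "inj_on (snd e) (fst e)" using c(3) d(3) by (auto simp: e inj_on_def)
  have "continuous_map (top_of_set (snd c ` fst c \<times> snd d ` fst d)) (top_of_set (snd c ` fst c)) fst"
    "continuous_map (top_of_set (snd c ` fst c \<times> snd d ` fst d)) (top_of_set (snd d ` fst d)) snd"
    by (auto intro!: continuous_intros)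
  from continuous_map_compose[OF this(1) c(4)] continuous_map_compose[OF this(2) d(4)]
  have "continuous_map (top_of_set (snd c ` fst c \<times> snd d ` fst d)) (prod_topology X Y) (\<lambda>x. (chart_inv c (fst x), chart_inv d (snd x)))"
    by (simp add: continuous_map_pairedI o_def)
  then show "continuous_map (top_of_set (snd e ` fst e)) (prod_topology X Y) (chart_inv e)"
    unfolding im by (rule continuous_map_eq) (auto simp: e chart_inv_prod c d)
qed

context
  fixes X :: "'m topology" and A :: "('m, 'e::euclidean_space) chart set" and c
  assumes A: "proper_atlas X A" and c: "c \<in> A"
begin

lemma proper_atlasD:
  "openin X (fst c)" "open (snd c ` fst c)" "inj_on (snd c) (fst c)"
  "continuous_map (top_of_set (snd c ` fst c)) X (chart_inv c)"
  "p \<in> fst c \<Longrightarrow> p \<in> topspace X"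
  using A c unfolding proper_atlas_def by auto

text \<open>The image is the preimage of \<open>W\<close> under the continuous map
  \<open>chart_inv c\<close>.\<close>

lemma open_chart_image:
  assumes "openin X W"
  shows "open (snd c ` (fst c \<inter> W))"
proof -
  have "openin (top_of_set (snd c ` fst c)) {x \<in> topspace (top_of_set (snd c ` fst c)). chart_inv c x \<in> W}"
    by (rule openin_continuous_map_preimage[OF proper_atlasD(4) assms])
  also have "{x \<in> topspace (top_of_set (snd c ` fst c)). chart_inv c x \<in> W} = snd c ` (fst c \<inter> W)"
    using chart_inv_chart[OF proper_atlasD(3)] by (auto simp: image_iff)
  finally show ?thesis using proper_atlasD(2) openin_open_trans by blast
qed

end

text \<open>\<open>smooth_map\<close> speaks of derivatives within the domain of the representation;
  once this domain is known to be open, they become full derivatives.\<close>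

lemma coord_rep_smooth:
  assumes A: "proper_atlas X A" and B: "proper_atlas Y B" and f: "smooth_map X A Y B f"
    and c: "c \<in> A" and d: "d \<in> B"
  shows "open (snd c ` {p \<in> fst c. f p \<in> fst d})"
    and "twice_differentiable_on (snd d \<circ> f \<circ> chart_inv c) (snd c ` {p \<in> fst c. f p \<in> fst d})"
proof -
  have "openin X {p \<in> topspace X. f p \<in> fst d}"
    using f proper_atlasD(1)[OF B d] by (intro openin_continuous_map_preimage) (auto simp: smooth_map_def)
  from open_chart_image[OF A c this]
  show op: "open (snd c ` {p \<in> fst c. f p \<in> fst d})"
    by (rule back_subst[of "open"]) (use proper_atlasD(5)[OF A c] in auto)
  have "smooth_on (snd c ` {p \<in> fst c. f p \<in> fst d}) (snd d \<circ> f \<circ> chart_inv c)"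
    using f c d unfolding smooth_map_def by (cases c, cases d) fastforce
  then show "twice_differentiable_on (snd d \<circ> f \<circ> chart_inv c) (snd c ` {p \<in> fst c. f p \<in> fst d})"
    using op by (rule smooth_on_imp_twice_differentiable_on)
qed

text \<open>All charts around \<open>p\<close> and \<open>f p\<close> are quantified, not only those
  picked by \<open>chart_at\<close>: \<open>geodesic\<close> is tested in arbitrary charts, so
  derivatives have to be moved between them.\<close>

definition mdiff :: "('m, 'e::euclidean_space) chart set \<Rightarrow> ('n, 'f::euclidean_space) chart set \<Rightarrow> ('m \<Rightarrow> 'n) \<Rightarrow> 'm \<Rightarrow> bool" where
  "mdiff A B f p \<longleftrightarrow> p \<in> \<Union>(fst ` A) \<and> f p \<in> \<Union>(fst ` B) \<and>
     (\<forall>c\<in>A. \<forall>d\<in>B. p \<in> fst c \<longrightarrow> f p \<in> fst d \<longrightarrow> coord_diff_at c d f p)"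

lemma smooth_map_mdiff:
  assumes A: "proper_atlas X A" and B: "proper_atlas Y B" and f: "smooth_map X A Y B f" and p: "p \<in> topspace X"
  shows "mdiff A B f p"
  unfolding mdiff_def coord_diff_at_def
proof (intro conjI ballI impI)
  show "p \<in> \<Union>(fst ` A)" using A p by (simp add: proper_atlas_def)
  show "f p \<in> \<Union>(fst ` B)" using B f p by (auto simp: proper_atlas_def smooth_map_def continuous_map_def)
  fix c d assume c: "c \<in> A" "p \<in> fst c" and d: "d \<in> B" "f p \<in> fst d"
  note S = coord_rep_smooth[OF A B f c(1) d(1)]
  have pS: "snd c p \<in> snd c ` {p \<in> fst c. f p \<in> fst d}" using c d by auto
  show "(snd d \<circ> f \<circ> chart_inv c) differentiable at (snd c p)" by (rule twice_differentiable_onD(1)[OF S(2) pS])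
  have "\<forall>\<^sub>F x in nhds (snd c p). x \<in> snd c ` {p \<in> fst c. f p \<in> fst d}"
    by (rule eventually_nhds_in_open[OF S(1) pS])
  then show "\<forall>\<^sub>F x in nhds (snd c p). f (chart_inv c x) \<in> fst d"
    by eventually_elim (use chart_inv_chart[OF proper_atlasD(3)[OF A c(1)]] in auto)
qed

text \<open>The middle chart cancels only near \<open>p\<close>, where \<open>f\<close> stays in its
  domain; continuity of the inner representation carries the corresponding condition for
  \<open>g\<close> back to the chart \<open>c\<close>.\<close>

lemma coord_diff_at_compose:
  assumes f: "coord_diff_at c d f p" and g: "coord_diff_at d e g (f p)"
    and c: "inj_on (snd c) (fst c)" "p \<in> fst c" and d: "inj_on (snd d) (fst d)"
  shows "coord_diff_at c e (g \<circ> f) p"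
    and "coord_deriv c e (g \<circ> f) p = coord_deriv d e g (f p) \<circ> coord_deriv c d f p"
proof -
  let ?f = "snd d \<circ> f \<circ> chart_inv c" and ?g = "snd e \<circ> g \<circ> chart_inv d" and ?x = "snd c p"
  have fx: "?f ?x = snd d (f p)" by (simp add: chart_inv_chart c)
  have D: "?f differentiable at ?x" "?g differentiable at (snd d (f p))"
    using f g by (auto simp: coord_diff_at_def)
  have h: "((\<lambda>x. ?g (?f x)) has_derivative (\<lambda>h. coord_deriv d e g (f p) (coord_deriv c d f p h))) (at ?x)"
    unfolding coord_deriv_def by (rule has_derivative_frechet_chain[OF has_derivative_frechet[OF D(1)] fx D(2)])
  have eqf: "\<forall>\<^sub>F x in nhds ?x. chart_inv d (?f x) = f (chart_inv c x)"
    using f unfolding coord_diff_at_def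
    by (auto elim!: eventually_mono simp: chart_inv_chart[OF d])
  have lim: "(?f \<longlongrightarrow> snd d (f p)) (nhds ?x)"
    using differentiable_imp_continuous_within[OF D(1)] fx by (metis continuous_within tendsto_at_iff_tendsto_nhds)
  have "\<forall>\<^sub>F y in nhds (snd d (f p)). g (chart_inv d y) \<in> fst e" using g by (simp add: coord_diff_at_def)
  then have "\<forall>\<^sub>F x in nhds ?x. g (chart_inv d (?f x)) \<in> fst e"
    by (rule eventually_compose_filterlim[OF _ lim])
  with eqf have ev: "\<forall>\<^sub>F x in nhds ?x. (g \<circ> f) (chart_inv c x) \<in> fst e"
    by eventually_elim simp
  have eq: "\<forall>\<^sub>F x in nhds ?x. ?g (?f x) = (snd e \<circ> (g \<circ> f) \<circ> chart_inv c) x"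
    using eqf by eventually_elim simp
  have hd: "(\<lambda>x. ?g (?f x)) differentiable at ?x" using h by (auto simp: differentiable_def)
  note r = differentiable_eventually_cong[OF hd eq]
  show "coord_diff_at c e (g \<circ> f) p" using ev r(1) by (simp add: coord_diff_at_def o_def)
  show "coord_deriv c e (g \<circ> f) p = coord_deriv d e g (f p) \<circ> coord_deriv c d f p"
    using r(2) frechet_derivativeI[OF h] by (simp add: coord_deriv_def[of c e] o_def)
qed

definition inj_atlas :: "('m, 'e) chart set \<Rightarrow> bool" where
  "inj_atlas A \<longleftrightarrow> (\<forall>c\<in>A. inj_on (snd c) (fst c))"

lemma proper_inj_atlas: "proper_atlas X A \<Longrightarrow> inj_atlas A"
  by (simp add: proper_atlas_def inj_atlas_def)

lemma chart_at_mem: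
  assumes "p \<in> \<Union>(fst ` A)" shows "chart_at A p \<in> A" "p \<in> fst (chart_at A p)"
proof -
  from assms obtain c where "c \<in> A \<and> p \<in> fst c" by auto
  from someI[of "\<lambda>c. c \<in> A \<and> p \<in> fst c", OF this]
  show "chart_at A p \<in> A" "p \<in> fst (chart_at A p)" by (auto simp: chart_at_def)
qed

lemma tangent_map_coord: "tangent_map A B f p = coord_deriv (chart_at A p) (chart_at B (f p)) f p"
  by (simp add: tangent_map_def coord_deriv_def)

lemma chart_change_coord: "chart_change c d p = coord_deriv c d id p"
  by (simp add: chart_change_def coord_deriv_def)

lemma mdiffD: "mdiff A B f p \<Longrightarrow> c \<in> A \<Longrightarrow> d \<in> B \<Longrightarrow> p \<in> fst c \<Longrightarrow> f p \<in> fst d \<Longrightarrow> coord_diff_at c d f p"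
  by (simp add: mdiff_def)

lemma mdiff_charts:
  assumes "mdiff A B f p"
  shows "chart_at A p \<in> A" "p \<in> fst (chart_at A p)" "chart_at B (f p) \<in> B" "f p \<in> fst (chart_at B (f p))"
  using assms chart_at_mem unfolding mdiff_def by metis+

lemma mdiff_compose:
  assumes A: "inj_atlas A" and B: "inj_atlas B" and f: "mdiff A B f p" and g: "mdiff B C g (f p)"
  shows "mdiff A C (g \<circ> f) p"
  unfolding mdiff_def
proof (intro conjI ballI impI)
  show "p \<in> \<Union>(fst ` A)" "(g \<circ> f) p \<in> \<Union>(fst ` C)" using f g by (auto simp: mdiff_def)
  fix c e assume c: "c \<in> A" "p \<in> fst c" and e: "e \<in> C" "(g \<circ> f) p \<in> fst e"
  obtain d where d: "d \<in> B" "f p \<in> fst d" using g by (auto simp: mdiff_def)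
  show "coord_diff_at c e (g \<circ> f) p"
    by (rule coord_diff_at_compose(1)[where d=d])
       (use A B c d e mdiffD[OF f] mdiffD[OF g] in \<open>auto simp: inj_atlas_def\<close>)
qed

lemma coord_deriv_compose:
  assumes A: "inj_atlas A" and B: "inj_atlas B" and f: "mdiff A B f p" and g: "mdiff B C g (f p)"
    and "c \<in> A" "p \<in> fst c" "d \<in> B" "f p \<in> fst d" "e \<in> C" "g (f p) \<in> fst e"
  shows "coord_deriv c e (g \<circ> f) p = coord_deriv d e g (f p) \<circ> coord_deriv c d f p"
  by (rule coord_diff_at_compose(2)) (use assms mdiffD[OF f] mdiffD[OF g] in \<open>auto simp: inj_atlas_def\<close>)

lemma tangent_map_compose:
  assumes A: "inj_atlas A" and B: "inj_atlas B" and f: "mdiff A B f p" and g: "mdiff B C g (f p)"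
  shows "tangent_map A C (g \<circ> f) p = tangent_map B C g (f p) \<circ> tangent_map A B f p"
  unfolding tangent_map_coord comp_apply[of g f p]
  by (rule coord_deriv_compose[OF A B f g mdiff_charts[OF f] mdiff_charts(3,4)[OF g]])

lemma coord_diff_at_cong:
  assumes "coord_diff_at c d f p" "open (snd c ` fst c)" "p \<in> fst c" "\<And>q. q \<in> fst c \<Longrightarrow> f q = g q"
  shows "coord_diff_at c d g p" "coord_deriv c d g p = coord_deriv c d f p"
proof -
  have "\<forall>\<^sub>F x in nhds (snd c p). x \<in> snd c ` fst c"
    using assms(2,3) by (simp add: eventually_nhds_in_open)
  then have ev: "\<forall>\<^sub>F x in nhds (snd c p). f (chart_inv c x) = g (chart_inv c x)"
    by eventually_elim (simp add: assms(4) chart_chart_inv)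
  from ev have ev': "\<forall>\<^sub>F x in nhds (snd c p). (snd d \<circ> f \<circ> chart_inv c) x = (snd d \<circ> g \<circ> chart_inv c) x"
    by eventually_elim simp
  have D: "(snd d \<circ> f \<circ> chart_inv c) differentiable at (snd c p)" using assms(1) by (simp add: coord_diff_at_def)
  note r = differentiable_eventually_cong[OF D ev']
  have "\<forall>\<^sub>F x in nhds (snd c p). f (chart_inv c x) \<in> fst d" using assms(1) by (simp add: coord_diff_at_def)
  with ev have "\<forall>\<^sub>F x in nhds (snd c p). g (chart_inv c x) \<in> fst d" by eventually_elim simp
  then show "coord_diff_at c d g p" "coord_deriv c d g p = coord_deriv c d f p"
    using r by (simp_all add: coord_diff_at_def coord_deriv_def o_def)
qed

text \<open>Equality is asked on \<open>topspace X\<close> because identities between maps built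
  from the group operations hold on the carrier.\<close>

lemma mdiff_cong:
  assumes A: "proper_atlas X A" and f: "mdiff A B f p" and fg: "\<And>q. q \<in> topspace X \<Longrightarrow> f q = g q"
  shows "mdiff A B g p" "tangent_map A B g p = tangent_map A B f p"
    "c \<in> A \<Longrightarrow> p \<in> fst c \<Longrightarrow> d \<in> B \<Longrightarrow> f p \<in> fst d \<Longrightarrow> coord_deriv c d g p = coord_deriv c d f p"
proof -
  have p: "f p = g p" using f A fg by (auto simp: mdiff_def proper_atlas_def)
  have *: "coord_diff_at c d g p \<and> coord_deriv c d g p = coord_deriv c d f p"
    if "c \<in> A" "p \<in> fst c" "d \<in> B" "f p \<in> fst d" for c d
    using coord_diff_at_cong[OF mdiffD[OF f that(1,3,2,4)] proper_atlasD(2)[OF A that(1)] that(2)]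
      fg proper_atlasD(5)[OF A that(1)] by metis
  then show "mdiff A B g p" using f p by (auto simp: mdiff_def)
  show "tangent_map A B g p = tangent_map A B f p"
    unfolding tangent_map_coord p[symmetric] using *[OF mdiff_charts[OF f]] by (rule conjunct2)
  show "c \<in> A \<Longrightarrow> p \<in> fst c \<Longrightarrow> d \<in> B \<Longrightarrow> f p \<in> fst d \<Longrightarrow> coord_deriv c d g p = coord_deriv c d f p"
    using * by blast
qed

lemma linear_coord_deriv: "mdiff A B f p \<Longrightarrow> c \<in> A \<Longrightarrow> d \<in> B \<Longrightarrow> p \<in> fst c \<Longrightarrow> f p \<in> fst d \<Longrightarrow> linear (coord_deriv c d f p)"
  unfolding coord_deriv_def by (rule linear_frechet_derivative) (simp add: mdiff_def coord_diff_at_def)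

lemma linear_tangent_map: "mdiff A B f p \<Longrightarrow> linear (tangent_map A B f p)"
  unfolding tangent_map_coord using linear_coord_deriv mdiff_charts by metis

text \<open>In charts the identity is a chart transition, which \<open>smooth_manifold\<close>
  requires to be smooth.\<close>

lemma mdiff_id:
  assumes "smooth_manifold X A" "p \<in> topspace X"
  shows "mdiff A A id p"
proof (rule smooth_map_mdiff)
  show A: "proper_atlas X A" "proper_atlas X A" using assms(1) by (rule smooth_manifold_proper)+
  show "smooth_map X A X A id"
    unfolding smooth_map_def using assms(1) by (fastforce simp: smooth_manifold_def Int_def)
qed (use assms in auto)

lemma coord_deriv_id:
  assumes A: "proper_atlas X A" and c: "c \<in> A" "p \<in> fst c"
  shows "coord_deriv c c id p = id"
proof -
  have "\<forall>\<^sub>F x in nhds (snd c p). x \<in> snd c ` fst c"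
    using proper_atlasD(2)[OF A c(1)] c by (simp add: eventually_nhds_in_open)
  then have "\<forall>\<^sub>F x in nhds (snd c p). id x = (snd c \<circ> id \<circ> chart_inv c) x"
    by eventually_elim (simp add: chart_chart_inv)
  from differentiable_eventually_cong(2)[OF _ this] show ?thesis by (simp add: coord_deriv_def id_def o_def)
qed

lemma coord_diff_at_Pair:
  assumes g: "coord_diff_at k c g p" and h: "coord_diff_at k d h p"
  shows "coord_diff_at k (fst c \<times> fst d, map_prod (snd c) (snd d)) (\<lambda>q. (g q, h q)) p"
    and "coord_deriv k (fst c \<times> fst d, map_prod (snd c) (snd d)) (\<lambda>q. (g q, h q)) p
       = (\<lambda>v. (coord_deriv k c g p v, coord_deriv k d h p v))"
proof -
  have ev: "\<forall>\<^sub>F x in nhds (snd k p). g (chart_inv k x) \<in> fst c \<and> h (chart_inv k x) \<in> fst d"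
    using g h by (auto simp: coord_diff_at_def intro: eventually_conj)
  have "((\<lambda>x. ((snd c \<circ> g \<circ> chart_inv k) x, (snd d \<circ> h \<circ> chart_inv k) x)) has_derivative
      (\<lambda>v. (coord_deriv k c g p v, coord_deriv k d h p v))) (at (snd k p))"
    unfolding coord_deriv_def using g h
    by (intro has_derivative_Pair) (simp_all only: coord_diff_at_def has_derivative_frechet)
  then have D: "((map_prod (snd c) (snd d) \<circ> (\<lambda>q. (g q, h q)) \<circ> chart_inv k) has_derivative
      (\<lambda>v. (coord_deriv k c g p v, coord_deriv k d h p v))) (at (snd k p))"
    by (simp add: o_def)
  then show "coord_diff_at k (fst c \<times> fst d, map_prod (snd c) (snd d)) (\<lambda>q. (g q, h q)) p"
    using ev unfolding coord_diff_at_def differentiable_def by auto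
  show "coord_deriv k (fst c \<times> fst d, map_prod (snd c) (snd d)) (\<lambda>q. (g q, h q)) p
       = (\<lambda>v. (coord_deriv k c g p v, coord_deriv k d h p v))"
    unfolding coord_deriv_def[of k "(_, _)"] snd_conv by (rule frechet_derivativeI[OF D])
qed

lemma mdiff_Pair:
  assumes g: "mdiff K A g p" and h: "mdiff K B h p"
  shows "mdiff K (prod_atlas A B) (\<lambda>q. (g q, h q)) p"
  unfolding mdiff_def
proof (intro conjI ballI impI)
  show "p \<in> \<Union>(fst ` K)" using g by (simp add: mdiff_def)
  obtain c d where cd: "c \<in> A" "g p \<in> fst c" "d \<in> B" "h p \<in> fst d" using g h by (auto simp: mdiff_def)
  then show "(g p, h p) \<in> \<Union>(fst ` prod_atlas A B)"
    using UN_I[OF prod_atlasI[OF cd(1,3)], of "(g p, h p)" fst] by simp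
  fix k e assume k: "k \<in> K" "p \<in> fst k" and e: "e \<in> prod_atlas A B" "(g p, h p) \<in> fst e"
  from e(1) obtain c d where cd: "c \<in> A" "d \<in> B" "e = (fst c \<times> fst d, map_prod (snd c) (snd d))"
    by (rule prod_atlasE)
  then show "coord_diff_at k e (\<lambda>q. (g q, h q)) p"
    using coord_diff_at_Pair(1)[OF mdiffD[OF g k(1) cd(1) k(2)] mdiffD[OF h k(1) cd(2) k(2)]] e(2) by simp
qed

lemma coord_diff_at_const:
  "a \<in> fst d \<Longrightarrow> coord_diff_at c d (\<lambda>_. a) p" "coord_deriv c d (\<lambda>_. a) p = (\<lambda>_. 0)"
  by (simp_all add: coord_diff_at_def coord_deriv_def o_def)

lemma mdiff_const: "p \<in> \<Union>(fst ` A) \<Longrightarrow> a \<in> \<Union>(fst ` B) \<Longrightarrow> mdiff A B (\<lambda>_. a) p"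
  by (simp add: mdiff_def coord_diff_at_const)

text \<open>The representation in one pair of charts is composed with chart transitions on both
  sides; their differentiability is the hypothesis on \<open>id\<close>. This serves
  \<open>Ad\<close>, which is computed in one chart.\<close>

lemma mdiff_single:
  assumes A: "inj_atlas A" "mdiff A A id p" and B: "inj_atlas B" "mdiff B B id (f p)"
    and c: "c \<in> A" "p \<in> fst c" and d: "d \<in> B" "f p \<in> fst d" and f: "coord_diff_at c d f p"
  shows "mdiff A B f p"
  unfolding mdiff_def
proof (intro conjI ballI impI)
  show "p \<in> \<Union>(fst ` A)" "f p \<in> \<Union>(fst ` B)" using c d by auto
  fix c' d' assume c': "c' \<in> A" "p \<in> fst c'" and d': "d' \<in> B" "f p \<in> fst d'"
  have inj: "inj_on (snd c) (fst c)" "inj_on (snd c') (fst c')" "inj_on (snd d) (fst d)"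
    using A B c c' d by (auto simp: inj_atlas_def)
  have 1: "coord_diff_at c' c id p" using mdiffD[OF A(2) c'(1) c(1) c'(2)] c by simp
  have 2: "coord_diff_at d d' id (f p)" using mdiffD[OF B(2) d(1) d'(1) d(2)] d' by simp
  have 3: "coord_diff_at c d' (id \<circ> f) p"
    by (rule coord_diff_at_compose(1)[OF f 2 inj(1) c(2) inj(3)])
  show "coord_diff_at c' d' f p"
    using coord_diff_at_compose(1)[OF 1 _ inj(2) c'(2) inj(1), of d' f] 3 by simp
qed

lemma tangent_map_id:
  assumes "proper_atlas X A" "p \<in> topspace X"
  shows "tangent_map A A id p = id"
proof -
  have "p \<in> \<Union>(fst ` A)" using assms by (simp add: proper_atlas_def)
  from chart_at_mem[OF this] show ?thesis
    by (simp add: tangent_map_coord coord_deriv_id[OF assms(1)])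
qed

section \<open>The standard atlas, velocities and partial derivatives\<close>

lemma std_atlas_mem [simp]: "(UNIV, id) \<in> std_atlas" "c \<in> std_atlas \<longleftrightarrow> c = (UNIV, id)"
  by (auto simp: std_atlas_def)

lemma chart_at_std: "chart_at std_atlas p = (UNIV, id)"
  using chart_at_mem(1)[of p std_atlas] by (simp add: std_atlas_def)

lemma chart_inv_std: "chart_inv (UNIV, id) = id"
  by (simp add: chart_inv_def fun_eq_iff inv_id[unfolded id_def])

lemma mdiff_std_iff:
  "mdiff std_atlas std_atlas f x \<longleftrightarrow> f differentiable at x"
  by (auto simp: mdiff_def std_atlas_def coord_diff_at_def chart_inv_std)

lemma tangent_map_std: "tangent_map std_atlas std_atlas f x = frechet_derivative f (at x)"
  by (simp add: tangent_map_def chart_at_std chart_inv_std)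

lemma coord_deriv_curve:
  assumes "mdiff (std_atlas :: (real, real) chart set) A c s" "d \<in> A" "c s \<in> fst d"
  shows "((snd d \<circ> c) has_vector_derivative coord_deriv (UNIV, id) d c s 1) (at s)"
proof -
  have "(snd d \<circ> c) differentiable at s"
    using mdiffD[OF assms(1) _ assms(2) _ assms(3), of "(UNIV, id)"] by (simp add: coord_diff_at_def chart_inv_std)
  moreover have "(\<lambda>r. r *\<^sub>R frechet_derivative (snd d \<circ> c) (at s) 1) = frechet_derivative (snd d \<circ> c) (at s)"
  proof
    fix r
    show "r *\<^sub>R frechet_derivative (snd d \<circ> c) (at s) 1 = frechet_derivative (snd d \<circ> c) (at s) r"
      using frechet_derivative_scaleR[OF calculation, of r 1] by simp
  qed
  ultimately show ?thesis
    using has_derivative_frechet[of "snd d \<circ> c" s] by (simp add: coord_deriv_def has_vector_derivative_def chart_inv_std)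
qed

lemma velocity_tangent_map:
  assumes "mdiff (std_atlas :: (real, real) chart set) A c s"
  shows "velocity A c s = tangent_map std_atlas A c s 1"
  using coord_deriv_curve[OF assms mdiff_charts(3,4)[OF assms]]
  by (simp add: velocity_def tangent_map_coord chart_at_std vector_derivative_at)

text \<open>Chain rule with the inclusion of a factor at a fixed point of the other; in coordinates
  the inclusion has derivative \<open>(v, 0)\<close> or \<open>(0, w)\<close>.\<close>

lemma coord_deriv_partial:
  assumes X: "smooth_manifold X A" and Y: "smooth_manifold Y B" and f: "mdiff (prod_atlas A B) C f (a, b)"
    and c: "c \<in> A" "a \<in> fst c" and d: "d \<in> B" "b \<in> fst d" and e: "e \<in> C" "f (a, b) \<in> fst e"
  shows "coord_deriv c e (\<lambda>a. f (a, b)) a v = coord_deriv (fst c \<times> fst d, map_prod (snd c) (snd d)) e f (a, b) (v, 0)"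
    and "coord_deriv d e (\<lambda>b. f (a, b)) b w = coord_deriv (fst c \<times> fst d, map_prod (snd c) (snd d)) e f (a, b) (0, w)"
proof -
  note PX = smooth_manifold_proper[OF X] and PY = smooth_manifold_proper[OF Y]
  note I = proper_inj_atlas[OF PX] proper_inj_atlas[OF PY] proper_inj_atlas[OF proper_prod_atlas[OF PX PY]]
  have ida: "mdiff A A (\<lambda>x. x) a" and idb: "mdiff B B (\<lambda>x. x) b"
    using mdiff_id[OF X proper_atlasD(5)[OF PX c]] mdiff_id[OF Y proper_atlasD(5)[OF PY d]] by (simp_all add: id_def)
  have ka: "mdiff A B (\<lambda>_. b) a" and kb: "mdiff B A (\<lambda>_. a) b"
    using c d by (auto intro!: mdiff_const)
  have cda: "coord_diff_at c c (\<lambda>x. x) a" "coord_diff_at c d (\<lambda>_. b) a"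
    using mdiffD[OF ida c(1) c(1) c(2)] mdiffD[OF ka c(1) d(1) c(2)] c d by auto
  have cdb: "coord_diff_at d d (\<lambda>x. x) b" "coord_diff_at d c (\<lambda>_. a) b"
    using mdiffD[OF idb d(1) d(1) d(2)] mdiffD[OF kb d(1) c(1) d(2)] c d by auto
  note pm = prod_atlasI[OF c(1) d(1)]
  have "coord_deriv c e (f \<circ> (\<lambda>a. (a, b))) a = coord_deriv (fst c \<times> fst d, map_prod (snd c) (snd d)) e f (a, b)
      \<circ> coord_deriv c (fst c \<times> fst d, map_prod (snd c) (snd d)) (\<lambda>a. (a, b)) a"
    by (rule coord_deriv_compose[OF I(1,3) mdiff_Pair[OF ida ka] f c pm _ e]) (use c d in simp)
  then show "coord_deriv c e (\<lambda>a. f (a, b)) a v = coord_deriv (fst c \<times> fst d, map_prod (snd c) (snd d)) e f (a, b) (v, 0)"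
    using coord_deriv_id[OF PX c] d coord_diff_at_Pair(2)[OF cda]
    by (simp add: o_def id_def coord_diff_at_const)
  have "coord_deriv d e (f \<circ> (\<lambda>b. (a, b))) b = coord_deriv (fst c \<times> fst d, map_prod (snd c) (snd d)) e f (a, b)
      \<circ> coord_deriv d (fst c \<times> fst d, map_prod (snd c) (snd d)) (\<lambda>b. (a, b)) b"
    by (rule coord_deriv_compose[OF I(2,3) mdiff_Pair[OF kb idb] f d pm _ e]) (use c d in simp)
  then show "coord_deriv d e (\<lambda>b. f (a, b)) b w = coord_deriv (fst c \<times> fst d, map_prod (snd c) (snd d)) e f (a, b) (0, w)"
    using coord_deriv_id[OF PY d] c coord_diff_at_Pair(2)[OF cdb(2,1)]
    by (simp add: o_def id_def coord_diff_at_const)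
qed


section \<open>Homogeneous spaces\<close>

locale homogeneous_space =
  fixes G (structure) and X :: "'g topology" and A :: "('g, 'e::euclidean_space) chart set"
    and H :: "'g set" and Y :: "'g set topology" and B :: "('g set, 'f::euclidean_space) chart set"
  assumes homogeneous: "homogeneous_manifold G X A H Y B"
begin

definition conj_by where "conj_by a b = a \<otimes> b \<otimes> inv a"

definition act_on where "act_on a S = a <#\<^bsub>G\<^esub> S"

definition proj where "proj a = a <#\<^bsub>G\<^esub> H"

lemma homogeneous_facts:
  shows lie: "lie_group G X A" and subgroup: "subgroup H G" and G: "group G"
    and topX: "topspace X = carrier G" and topY: "topspace Y = lcosets\<^bsub>G\<^esub> H"
    and X: "smooth_manifold X A" and Y: "smooth_manifold Y B"
    and proj: "smooth_map X A Y B proj"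
    and act: "smooth_map (prod_topology X Y) (prod_atlas A B) Y B (\<lambda>(a, S). act_on a S)"
    and mult: "smooth_map (prod_topology X X) (prod_atlas A A) X A (\<lambda>(a, b). a \<otimes> b)"
    and inv: "smooth_map X A X A (\<lambda>a. inv a)"
    and proj_surj: "\<And>a. a \<in> carrier G \<Longrightarrow> surj (tangent_map A B proj a)"
  using homogeneous unfolding homogeneous_manifold_def lie_group_def proj_def[abs_def] act_on_def[abs_def] by auto

sublocale group G by (rule G)

lemmas AX = smooth_manifold_proper[OF X] and BY = smooth_manifold_proper[OF Y]
lemmas AI = proper_inj_atlas[OF AX] and BI = proper_inj_atlas[OF BY]
lemmas AA = proper_prod_atlas[OF AX AX] and AB = proper_prod_atlas[OF AX BY]
lemmas SI = proper_inj_atlas[OF proper_std_atlas]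

lemma H_carrier: "H \<subseteq> carrier G" using subgroup by (rule subgroup.subset)

lemma mem_cosets: "a \<in> carrier G \<Longrightarrow> proj a \<in> lcosets\<^bsub>G\<^esub> H"
  by (auto simp: proj_def LCOSETS_def)

lemma cosetE: assumes "S \<in> lcosets\<^bsub>G\<^esub> H" obtains a where "a \<in> carrier G" "S = proj a"
  using assms by (auto simp: proj_def LCOSETS_def)

lemma act_proj: "a \<in> carrier G \<Longrightarrow> b \<in> carrier G \<Longrightarrow> act_on a (proj b) = proj (a \<otimes> b)"
  by (simp add: act_on_def proj_def lcos_m_assoc H_carrier)

lemma proj_one: "proj \<one> = H" by (simp add: proj_def lcos_mult_one H_carrier)

lemma act_cosets: "a \<in> carrier G \<Longrightarrow> S \<in> lcosets\<^bsub>G\<^esub> H \<Longrightarrow> act_on a S \<in> lcosets\<^bsub>G\<^esub> H"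
  by (erule cosetE) (simp add: act_proj mem_cosets)

lemma act_act: "a \<in> carrier G \<Longrightarrow> b \<in> carrier G \<Longrightarrow> S \<in> lcosets\<^bsub>G\<^esub> H \<Longrightarrow> act_on a (act_on b S) = act_on (a \<otimes> b) S"
  by (erule cosetE) (simp add: act_proj m_assoc)

lemma act_one: "S \<in> lcosets\<^bsub>G\<^esub> H \<Longrightarrow> act_on \<one> S = S"
  by (erule cosetE) (simp add: act_proj)

section \<open>Differentiability of translations, orbit maps and conjugations\<close>

lemma mA: "a \<in> carrier G \<Longrightarrow> a \<in> \<Union>(fst ` A)" using AX topX by (simp add: proper_atlas_def)
lemma mB: "S \<in> lcosets\<^bsub>G\<^esub> H \<Longrightarrow> S \<in> \<Union>(fst ` B)" using BY topY by (simp add: proper_atlas_def)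

lemma mdiff_mult: "mdiff (prod_atlas A A) A (\<lambda>(a, b). a \<otimes> b) (a, b)" if "a \<in> carrier G" "b \<in> carrier G"
  by (rule smooth_map_mdiff[OF AA AX mult]) (use that topX in simp)

lemma mdiff_act2: "mdiff (prod_atlas A B) B (\<lambda>(a, S). act_on a S) (a, S)" if "a \<in> carrier G" "S \<in> lcosets\<^bsub>G\<^esub> H"
  by (rule smooth_map_mdiff[OF AB BY act]) (use that topX topY in simp)

lemma mdiff_proj: "a \<in> carrier G \<Longrightarrow> mdiff A B proj a"
  by (rule smooth_map_mdiff[OF AX BY proj]) (simp add: topX)

lemma mdiff_idA: "a \<in> carrier G \<Longrightarrow> mdiff A A (\<lambda>x. x) a"
  using mdiff_id[OF X] by (simp add: topX id_def)
lemma mdiff_idB: "S \<in> lcosets\<^bsub>G\<^esub> H \<Longrightarrow> mdiff B B (\<lambda>x. x) S"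
  using mdiff_id[OF Y] by (simp add: topY id_def)

lemma mdiff_left: assumes "a \<in> carrier G" "b \<in> carrier G" shows "mdiff A A (\<lambda>b. a \<otimes> b) b"
  using mdiff_compose[OF AI proper_inj_atlas[OF AA] mdiff_Pair[OF mdiff_const mdiff_idA] mdiff_mult[OF assms]] assms mA
  by (simp add: o_def)

lemma mdiff_right: assumes "a \<in> carrier G" "b \<in> carrier G" shows "mdiff A A (\<lambda>a. a \<otimes> b) a"
  using mdiff_compose[OF AI proper_inj_atlas[OF AA] mdiff_Pair[OF mdiff_idA mdiff_const] mdiff_mult[OF assms]] assms mA
  by (simp add: o_def)

lemma mdiff_act: assumes "a \<in> carrier G" "S \<in> lcosets\<^bsub>G\<^esub> H" shows "mdiff B B (act_on a) S"
  using mdiff_compose[OF BI proper_inj_atlas[OF AB] mdiff_Pair[OF mdiff_const mdiff_idB] mdiff_act2[OF assms]] assms mA mB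
  by (simp add: o_def)

lemma mdiff_orbit: assumes "a \<in> carrier G" "S \<in> lcosets\<^bsub>G\<^esub> H" shows "mdiff A B (\<lambda>a. act_on a S) a"
  using mdiff_compose[OF AI proper_inj_atlas[OF AB] mdiff_Pair[OF mdiff_idA mdiff_const] mdiff_act2[OF assms]] assms mA mB
  by (simp add: o_def)

lemma mdiff_conj: assumes "a \<in> carrier G" "b \<in> carrier G" shows "mdiff A A (conj_by a) b"
  using mdiff_compose[OF AI AI mdiff_left[OF assms] mdiff_right[of "a \<otimes> b" "inv a"]] assms
  by (simp add: o_def conj_by_def[abs_def])

lemma conj_one: "a \<in> carrier G \<Longrightarrow> conj_by a \<one> = \<one>"
  by (simp add: conj_by_def)

lemma Ad_tangent: "Ad G A a = tangent_map A A (conj_by a) \<one>"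
  by (simp add: Ad_def conj_by_def[abs_def])

lemma dproj_tangent: "dproj G A H B = tangent_map A B proj \<one>"
  by (simp add: dproj_def proj_def[abs_def])

lemma dact_tangent: "dact G B a = tangent_map B B (act_on a)"
  by (simp add: dact_def act_on_def[abs_def])

lemma linear_dproj: "linear (dproj G A H B)"
  unfolding dproj_tangent by (intro linear_tangent_map mdiff_proj one_closed)

section \<open>Multiplicativity of \<open>Ad\<close> and of the differential of the action\<close>

lemma Ad_mult:
  assumes "a \<in> carrier G" "b \<in> carrier G"
  shows "Ad G A (a \<otimes> b) = Ad G A a \<circ> Ad G A b"
proof -
  have m: "mdiff A A (conj_by a) (conj_by b \<one>)" using assms by (simp add: conj_one mdiff_conj)
  have "Ad G A (a \<otimes> b) = tangent_map A A (conj_by a \<circ> conj_by b) \<one>"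
    unfolding Ad_tangent
    by (rule mdiff_cong(2)[OF AX mdiff_compose[OF AI AI mdiff_conj[OF assms(2) one_closed] m]])
       (use assms topX in \<open>simp add: conj_by_def m_assoc inv_mult_group\<close>)
  also have "\<dots> = Ad G A a \<circ> Ad G A b"
    using tangent_map_compose[OF AI AI mdiff_conj[OF assms(2) one_closed] m] assms by (simp add: Ad_tangent conj_one)
  finally show ?thesis .
qed

lemma Ad_one: "Ad G A \<one> = id"
proof -
  have "Ad G A \<one> = tangent_map A A id \<one>"
    unfolding Ad_tangent
    by (rule mdiff_cong(2)[OF AX mdiff_id[OF X]]) (use topX in \<open>auto simp: conj_by_def\<close>)
  then show ?thesis using tangent_map_id[OF AX] topX by simp
qed

lemma surj_Ad: "a \<in> carrier G \<Longrightarrow> surj (Ad G A a)"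
  using Ad_mult[of a "inv a"] Ad_one by (simp add: o_def fun_eq_iff) (metis surjI)

lemma dact_mult:
  assumes "a \<in> carrier G" "b \<in> carrier G" "S \<in> lcosets\<^bsub>G\<^esub> H"
  shows "dact G B (a \<otimes> b) S = dact G B a (act_on b S) \<circ> dact G B b S"
proof -
  note m = mdiff_act[OF assms(2,3)] mdiff_act[OF assms(1) act_cosets[OF assms(2,3)]]
  have "dact G B (a \<otimes> b) S = tangent_map B B (act_on a \<circ> act_on b) S"
    unfolding dact_tangent
    by (rule mdiff_cong(2)[OF BY mdiff_compose[OF BI BI m]]) (use assms topY in \<open>simp add: act_act\<close>)
  then show ?thesis using tangent_map_compose[OF BI BI m] by (simp add: dact_tangent)
qed

lemma dact_one: "S \<in> lcosets\<^bsub>G\<^esub> H \<Longrightarrow> dact G B \<one> S = id"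
proof -
  assume S: "S \<in> lcosets\<^bsub>G\<^esub> H"
  have "dact G B \<one> S = tangent_map B B id S"
    unfolding dact_tangent
    by (rule mdiff_cong(2)[OF BY mdiff_id[OF Y]]) (use topY S in \<open>auto simp: act_one\<close>)
  then show ?thesis using tangent_map_id[OF BY] topY S by simp
qed

lemma inj_dact: "a \<in> carrier G \<Longrightarrow> S \<in> lcosets\<^bsub>G\<^esub> H \<Longrightarrow> inj (dact G B a S)"
  using dact_mult[of "inv a" a S] dact_one[of S] by (simp add: o_def fun_eq_iff) (metis injI)

end


section \<open>One-parameter subgroups and the adjoint representation\<close>

context homogeneous_space
begin

abbreviation (input) "chart1 \<equiv> chart_at A \<one>"

lemma chart1: "chart1 \<in> A" "\<one> \<in> fst chart1"
  using chart_at_mem[OF mA[OF one_closed]] by auto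

lemma chart_carrier: "k \<in> A \<Longrightarrow> a \<in> fst k \<Longrightarrow> a \<in> carrier G"
  using proper_atlasD(5)[OF AX] topX by blast

lemma chart_cosets: "k \<in> B \<Longrightarrow> S \<in> fst k \<Longrightarrow> S \<in> lcosets\<^bsub>G\<^esub> H"
  using proper_atlasD(5)[OF BY] topY by blast

text \<open>
  In the chart at \<open>\<one>\<close>, \<open>Ad a Z\<close> is \<open>D\<^sub>1 \<mu>(a, a\<inverse>) (D\<^sub>2 \<mu>(a, \<one>) Z)\<close> for the multiplication \<open>\<mu>\<close>.
\<close>

lemma mdiff_Ad: "mdiff A std_atlas (\<lambda>a. Ad G A a Z) \<one>"
proof -
  define k where "k = chart1"
  have k: "k \<in> A" "\<one> \<in> fst k" using chart1 by (auto simp: k_def)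
  define kk where "kk = (fst k \<times> fst k, map_prod (snd k) (snd k))"
  define m where "m = (\<lambda>(a, b). a \<otimes> b)"
  define \<mu> where "\<mu> = snd k \<circ> m \<circ> chart_inv kk"
  \<comment> \<open>Coordinates of the pairs whose product again lies in the domain of
    \<open>k\<close>: the open set on which \<open>\<mu>\<close> represents the
    multiplication.\<close>
  define S where "S = snd kk ` {p \<in> fst kk. m p \<in> fst k}"
  define \<iota> where "\<iota> = snd k \<circ> (\<lambda>a. inv a) \<circ> chart_inv k"
  have kk: "kk \<in> prod_atlas A A" unfolding kk_def by (rule prod_atlasI[OF k(1) k(1)])
  note S = coord_rep_smooth[OF AA AX mult kk k(1), folded m_def, folded S_def \<mu>_def]
  have mS: "(snd k a, snd k b) \<in> S" if "a \<in> fst k" "b \<in> fst k" "a \<otimes> b \<in> fst k" for a b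
    unfolding S_def by (rule image_eqI[of _ _ "(a, b)"]) (use that in \<open>auto simp: kk_def m_def\<close>)
  have invk: "mdiff A A (\<lambda>a. inv a) \<one>" by (rule smooth_map_mdiff[OF AX AX inv]) (simp add: topX)
  have invk': "coord_diff_at k k (\<lambda>a. inv a) \<one>" using mdiffD[OF invk k(1) k(1) k(2)] k(2) by simp
  have \<iota>: "\<iota> differentiable at (snd k \<one>)" using invk' by (simp add: coord_diff_at_def \<iota>_def)
  have \<iota>1: "\<iota> (snd k \<one>) = snd k \<one>"
    by (simp add: \<iota>_def chart_inv_chart[OF proper_atlasD(3)[OF AX k(1)] k(2)])
  have e0S: "(snd k \<one>, snd k \<one>) \<in> S" using mS[of \<one> \<one>] k by simp
  \<comment> \<open>The formula evaluates a derivative of \<open>\<mu>\<close> at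
    \<open>(a, inv a)\<close>, so \<open>inv a\<close> has to lie in the domain of the chart as
    well.\<close>
  have ev: "\<forall>\<^sub>F x in nhds (snd k \<one>). x \<in> snd k ` fst k \<and> inv (chart_inv k x) \<in> fst k"
    using invk' eventually_nhds_in_open[OF proper_atlasD(2)[OF AX k(1)], of "snd k \<one>"] k(2)
    by (auto simp: coord_diff_at_def intro: eventually_conj)
  define V where "V x = frechet_derivative \<mu> (at (x, snd k \<one>)) (0, Z)" for x
  define P where "P x v = frechet_derivative \<mu> (at (x, \<iota> x)) (v, 0)" for x v
  have formula: "Ad G A (chart_inv k x) Z = P x (V x) \<and> (x, \<iota> x) \<in> S"
    if "x \<in> snd k ` fst k \<and> inv (chart_inv k x) \<in> fst k" for x
  proof -
    define a where "a = chart_inv k x"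
    have a: "snd k a = x" "a \<in> fst k" "inv a \<in> fst k" using chart_chart_inv[of x k] that by (auto simp: a_def)
    have aG: "a \<in> carrier G" using chart_carrier[OF k(1) a(2)] .
    have m1: "mdiff (prod_atlas A A) A m (a, \<one>)" "mdiff (prod_atlas A A) A m (a, inv a)"
      using mdiff_mult aG by (auto simp: m_def)
    have eq: "coord_deriv (fst k \<times> fst k, map_prod (snd k) (snd k)) k m p = frechet_derivative \<mu> (at (snd k (fst p), snd k (snd p)))" for p
      by (cases p) (simp add: coord_deriv_def \<mu>_def kk_def)
    have m: "m (a, \<one>) \<in> fst k" "m (a, inv a) \<in> fst k" using a k aG by (auto simp: m_def)
    have 1: "coord_deriv k k (\<lambda>b. a \<otimes> b) \<one> v = frechet_derivative \<mu> (at (x, snd k \<one>)) (0, v)" for v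
      using coord_deriv_partial(2)[OF X X m1(1) k(1) a(2) k k(1) m(1), of v, unfolded eq] a(1) by (simp add: m_def)
    have 2: "coord_deriv k k (\<lambda>b. b \<otimes> inv a) a v = frechet_derivative \<mu> (at (x, \<iota> x)) (v, 0)" for v
      using coord_deriv_partial(1)[OF X X m1(2) k(1) a(2) k(1) a(3) k(1) m(2), of v, unfolded eq] a(1)
      by (simp add: m_def \<iota>_def a_def[symmetric])
    \<comment> \<open>Conjugation is left multiplication by \<open>a\<close> followed by right
      multiplication by \<open>inv a\<close>; it leads from \<open>\<one>\<close> through
      \<open>a\<close> back to \<open>\<one>\<close>, all within the domain of
      \<open>k\<close>.\<close>
    have "coord_deriv k k ((\<lambda>b. b \<otimes> inv a) \<circ> (\<lambda>b. a \<otimes> b)) \<one> = coord_deriv k k (\<lambda>b. b \<otimes> inv a) (a \<otimes> \<one>) \<circ> coord_deriv k k (\<lambda>b. a \<otimes> b) \<one>"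
      by (rule coord_deriv_compose[OF AI AI mdiff_left mdiff_right]) (use a aG k in auto)
    then have "coord_deriv k k (conj_by a) \<one> Z = P x (V x)"
      using aG by (simp add: o_def conj_by_def[abs_def] 1 2 P_def V_def)
    moreover have "Ad G A a = coord_deriv k k (conj_by a) \<one>"
      unfolding Ad_tangent tangent_map_coord conj_one[OF aG] k_def ..
    moreover have "(x, \<iota> x) \<in> S" using mS[OF a(2,3)] k aG a by (simp add: \<iota>_def a_def[symmetric])
    ultimately show ?thesis by (simp add: a_def)
  qed
  \<comment> \<open>On fixed vectors, \<open>P\<close> and \<open>V\<close> are first derivatives of
    \<open>\<mu>\<close>, hence differentiable because \<open>\<mu>\<close> is twice differentiable;
    the moving argument \<open>V x\<close> is handled by linearity of \<open>P x\<close>.\<close>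
  have PV: "(\<lambda>x. P x (V x)) differentiable at (snd k \<one>)"
  proof (rule differentiable_linear_family[where P=P and V=V])
    show "\<forall>\<^sub>F x in nhds (snd k \<one>). linear (P x)"
    proof (rule eventually_mono[OF ev])
      fix x assume x: "x \<in> snd k ` fst k \<and> inv (chart_inv k x) \<in> fst k"
      have "linear (frechet_derivative \<mu> (at (x, \<iota> x)))"
        by (rule linear_frechet_derivative, rule twice_differentiable_onD(1)[OF S(2)]) (use formula[OF x] in simp)
      moreover have "linear (\<lambda>v::'e. (v, 0::'e))" by (simp add: linear_iff)
      ultimately show "linear (P x)" using linear_compose unfolding P_def[abs_def] o_def by blast
    qed
    have d1: "(\<lambda>x. (x, \<iota> x)) differentiable at (snd k \<one>)" "(\<lambda>x. (x, snd k \<one>)) differentiable at (snd k \<one>)"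
      using has_derivative_Pair[OF has_derivative_ident has_derivative_frechet[OF \<iota>]]
        has_derivative_Pair[OF has_derivative_ident has_derivative_const] unfolding differentiable_def by blast+
    show "(\<lambda>x. P x v) differentiable at (snd k \<one>)" for v
      unfolding P_def by (rule differentiable_frechet_chain[OF d1(1)]) (use twice_differentiable_onD(2)[OF S(2) e0S] in \<open>simp add: \<iota>1\<close>)
    show "V differentiable at (snd k \<one>)"
      unfolding V_def by (rule differentiable_frechet_chain[OF d1(2)]) (use twice_differentiable_onD(2)[OF S(2) e0S] in simp)
  qed
  have "\<forall>\<^sub>F x in nhds (snd k \<one>). P x (V x) = (snd (UNIV, id) \<circ> (\<lambda>a. Ad G A a Z) \<circ> chart_inv k) x"
    using ev by eventually_elim (simp add: formula)
  from differentiable_eventually_cong(1)[OF PV this]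
  have "coord_diff_at k (UNIV, id) (\<lambda>a. Ad G A a Z) \<one>" by (simp add: coord_diff_at_def o_def)
  then show ?thesis
    using k mdiff_id[OF X, of \<one>] topX by (intro mdiff_single[OF AI _ SI]) (auto simp: mdiff_std_iff id_def)
qed

text \<open>Since b a H = a (inv a b a) H, the orbit map at \<open>proj a\<close> is conjugation by
  \<open>inv a\<close>, then projection, then translation by \<open>a\<close>. So the fundamental
  field of \<open>Z\<close> at \<open>proj a\<close> is the translate of a tangent vector at the
  base point.\<close>

lemma killing_coord:
  assumes a: "a \<in> carrier G" and k: "k \<in> B" "proj a \<in> fst k"
  shows "coord_deriv chart1 k (\<lambda>b. act_on b (proj a)) \<one> Z = coord_deriv (chart_at B H) k (act_on a) H (dproj G A H B (Ad G A (inv a) Z))"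
proof -
  define h where "h = chart_at B H"
  have Ho: "H \<in> lcosets\<^bsub>G\<^esub> H" using mem_cosets[OF one_closed] proj_one by simp
  have h: "h \<in> B" "H \<in> fst h" unfolding h_def using chart_at_mem[OF mB[OF Ho]] by auto
  have m1: "mdiff A A (conj_by (inv a)) \<one>" using a by (simp add: mdiff_conj)
  have m2: "mdiff A B proj (conj_by (inv a) \<one>)" using a by (simp add: mdiff_proj conj_one)
  have m12: "mdiff A B (proj \<circ> conj_by (inv a)) \<one>" by (rule mdiff_compose[OF AI AI m1 m2])
  have m3: "mdiff B B (act_on a) ((proj \<circ> conj_by (inv a)) \<one>)" using a Ho by (simp add: mdiff_act conj_one proj_one)
  have mo: "mdiff A B (\<lambda>b. act_on b (proj a)) \<one>" using a by (intro mdiff_orbit mem_cosets one_closed)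
  have aH: "act_on a H = proj a" using act_proj[OF a one_closed] a by (simp add: proj_one)
  have "coord_deriv chart1 k (act_on a \<circ> (proj \<circ> conj_by (inv a))) \<one> = coord_deriv chart1 k (\<lambda>b. act_on b (proj a)) \<one>"
    by (rule mdiff_cong(3)[OF AX mo _ chart1 k(1)])
       (use a k in \<open>auto simp: topX act_proj conj_by_def m_assoc[symmetric] act_one mem_cosets\<close>)
  moreover have "coord_deriv chart1 k (act_on a \<circ> (proj \<circ> conj_by (inv a))) \<one> =
     coord_deriv h k (act_on a) ((proj \<circ> conj_by (inv a)) \<one>) \<circ> coord_deriv chart1 h (proj \<circ> conj_by (inv a)) \<one>"
    by (rule coord_deriv_compose[OF AI BI m12 m3 chart1 h(1) _ k(1)])
       (use a k h in \<open>auto simp: conj_one proj_one aH\<close>)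
  moreover have "coord_deriv chart1 h (proj \<circ> conj_by (inv a)) \<one> =
     coord_deriv chart1 h proj (conj_by (inv a) \<one>) \<circ> coord_deriv chart1 chart1 (conj_by (inv a)) \<one>"
    by (rule coord_deriv_compose[OF AI AI m1 m2 chart1 chart1(1) _ h(1)])
       (use a k h chart1 in \<open>auto simp: conj_one proj_one\<close>)
  ultimately have "coord_deriv chart1 k (\<lambda>b. act_on b (proj a)) \<one> =
      coord_deriv h k (act_on a) H \<circ> (coord_deriv chart1 h proj \<one> \<circ> coord_deriv chart1 chart1 (conj_by (inv a)) \<one>)"
    using a by (simp add: conj_one proj_one)
  from fun_cong[OF this, of Z] show ?thesis
    using a by (simp add: conj_one proj_one dproj_tangent Ad_tangent tangent_map_coord h_def)
qed

context
  fixes c X0 assumes c: "is_exp_curve G X A X0 c"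
begin

lemma exp_curve:
  shows "c t \<in> carrier G" "c (s + t) = c s \<otimes> c t" "c 0 = \<one>" "c (- t) = inv (c t)"
    "mdiff std_atlas A c t" "velocity A c 0 = X0"
proof -
  have sm: "smooth_map euclideanreal std_atlas X A c" using c by (simp add: is_exp_curve_def smooth_curve_def)
  then have "continuous_map euclideanreal X c" by (simp add: smooth_map_def)
  then show C: "c t \<in> carrier G" for t using topX by (auto simp: continuous_map_def)
  show add: "c (s + t) = c s \<otimes> c t" for s t using c by (simp add: is_exp_curve_def)
  show 0: "c 0 = \<one>" using add[of 0 0] C[of 0] by simp
  show "c (- t) = inv (c t)" using add[of "- t" t] 0 C by (simp add: inv_equality)
  show "mdiff std_atlas A c t" by (rule smooth_map_mdiff[OF proper_std_atlas AX sm]) simp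
  show "velocity A c 0 = X0" using c by (simp add: is_exp_curve_def)
qed

lemma mdiff_orbit_curve: "mdiff std_atlas B (\<lambda>s. proj (c s)) t"
  using mdiff_compose[OF SI AI exp_curve(5) mdiff_proj[OF exp_curve(1)]] by (simp add: o_def)

text \<open>By the one-parameter property, \<open>proj (c u)\<close> is the translate by
  \<open>c s\<close> of \<open>proj (c (u - s))\<close>; hence the velocity at \<open>s\<close> is
  the translate of the initial one. \<open>\<tau>\<close> is this shift of time.\<close>

lemma orbit_velocity_coord:
  assumes k: "k \<in> B" "proj (c s) \<in> fst k"
  shows "coord_deriv (UNIV, id) k (\<lambda>s. proj (c s)) s 1 = coord_deriv (chart_at B H) k (act_on (c s)) H (dproj G A H B X0)"
proof -
  define h where "h = chart_at B H"
  define \<sigma> where "\<sigma> = (UNIV :: real set, id :: real \<Rightarrow> real)"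
  define \<tau> where "\<tau> u = u - s" for u :: real
  have \<sigma>: "\<sigma> \<in> std_atlas" "x \<in> fst \<sigma>" for x by (auto simp: \<sigma>_def)
  have Ho: "H \<in> lcosets\<^bsub>G\<^esub> H" using mem_cosets[OF one_closed] proj_one by simp
  have h: "h \<in> B" "H \<in> fst h" unfolding h_def using chart_at_mem[OF mB[OF Ho]] by auto
  have \<tau>d: "(\<tau> has_derivative (\<lambda>h. h)) (at s)" unfolding \<tau>_def[abs_def] by (auto intro!: derivative_eq_intros)
  then have m1: "mdiff std_atlas std_atlas \<tau> s" by (auto simp: mdiff_std_iff differentiable_def)
  have \<tau>': "coord_deriv \<sigma> \<sigma> \<tau> s = (\<lambda>h. h)"
    using frechet_derivativeI[OF \<tau>d] by (simp add: coord_deriv_def \<sigma>_def chart_inv_std)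
  have m2: "mdiff std_atlas A c (\<tau> s)" by (rule exp_curve(5))
  have m3: "mdiff A B proj (c (\<tau> s))" by (intro mdiff_proj exp_curve)
  have m23: "mdiff std_atlas B (proj \<circ> c) (\<tau> s)" by (rule mdiff_compose[OF SI AI m2 m3])
  have p0: "(proj \<circ> c) (\<tau> s) = H" by (simp add: \<tau>_def exp_curve(3) proj_one)
  have m4: "mdiff B B (act_on (c s)) ((proj \<circ> c) (\<tau> s))"
    unfolding p0 by (intro mdiff_act exp_curve Ho)
  have aH: "act_on (c s) H = proj (c s)" using act_proj[OF exp_curve(1) one_closed] exp_curve(1) by (simp add: proj_one)
  have "(\<lambda>s. proj (c s)) = (act_on (c s) \<circ> (proj \<circ> c)) \<circ> \<tau>"
    by (auto simp: fun_eq_iff act_proj exp_curve(1) exp_curve(2)[symmetric] \<tau>_def)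
  moreover have "coord_deriv \<sigma> k ((act_on (c s) \<circ> (proj \<circ> c)) \<circ> \<tau>) s = coord_deriv \<sigma> k (act_on (c s) \<circ> (proj \<circ> c)) (\<tau> s) \<circ> coord_deriv \<sigma> \<sigma> \<tau> s"
    by (rule coord_deriv_compose[OF SI SI m1 mdiff_compose[OF SI BI m23 m4] \<sigma> \<sigma> k(1)])
       (use k p0 aH in simp)
  moreover have "coord_deriv \<sigma> k (act_on (c s) \<circ> (proj \<circ> c)) (\<tau> s) = coord_deriv h k (act_on (c s)) ((proj \<circ> c) (\<tau> s)) \<circ> coord_deriv \<sigma> h (proj \<circ> c) (\<tau> s)"
    by (rule coord_deriv_compose[OF SI BI m23 m4 \<sigma> h(1) _ k(1)]) (use k p0 aH h in auto)
  moreover have "coord_deriv \<sigma> h (proj \<circ> c) (\<tau> s) = coord_deriv chart1 h proj (c (\<tau> s)) \<circ> coord_deriv \<sigma> chart1 c (\<tau> s)"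
    by (rule coord_deriv_compose[OF SI AI m2 m3 \<sigma> chart1(1) _ h(1)])
       (use p0 h chart1 in \<open>auto simp: \<tau>_def exp_curve(3)\<close>)
  moreover have "coord_deriv \<sigma> chart1 c (\<tau> s) 1 = X0"
    using velocity_tangent_map[OF exp_curve(5), of 0] exp_curve(3,6)
    by (simp add: tangent_map_coord chart_at_std \<sigma>_def \<tau>_def)
  moreover have \<tau>0: "\<tau> s = 0" by (simp add: \<tau>_def)
  ultimately show ?thesis
    using p0 by (simp add: \<tau>'[unfolded \<sigma>_def] \<tau>0 exp_curve(3) proj_one dproj_tangent tangent_map_coord h_def \<sigma>_def)
qed

text \<open>Writing \<open>c (- s) = c (t - s) \<otimes> c (- t)\<close> reduces an arbitrary time
  to the derivative of \<open>Ad\<close> at \<open>\<one>\<close>, where \<open>lie_bracket\<close>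
  and \<open>mdiff_Ad\<close> apply; the sign is that of \<open>- s\<close> in
  \<open>t - s\<close>.\<close>

lemma Ad_curve:
  "((\<lambda>s. Ad G A (c (- s)) Z) has_vector_derivative - lie_bracket G A X0 (Ad G A (c (- t)) Z)) (at t)"
proof -
  define Z' where "Z' = Ad G A (c (- t)) Z"
  define \<tau> where "\<tau> u = t - u" for u :: real
  have \<tau>d: "(\<tau> has_derivative (\<lambda>h. - h)) (at t)" unfolding \<tau>_def[abs_def] by (auto intro!: derivative_eq_intros)
  then have m1: "mdiff std_atlas std_atlas \<tau> t" by (auto simp: mdiff_std_iff differentiable_def)
  have m2: "mdiff std_atlas A c (\<tau> t)" by (rule exp_curve(5))
  have m3: "mdiff A std_atlas (\<lambda>a. Ad G A a Z') (c (\<tau> t))" using mdiff_Ad exp_curve(3) by (simp add: \<tau>_def)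
  have m12: "mdiff std_atlas A (c \<circ> \<tau>) t" by (rule mdiff_compose[OF SI SI m1 m2])
  have m3': "mdiff A std_atlas (\<lambda>a. Ad G A a Z') ((c \<circ> \<tau>) t)" using m3 by simp
  define f where "f = (\<lambda>a. Ad G A a Z') \<circ> (c \<circ> \<tau>)"
  have m: "mdiff std_atlas std_atlas f t" unfolding f_def by (rule mdiff_compose[OF SI AI m12 m3'])
  have "tangent_map std_atlas std_atlas f t = tangent_map A std_atlas (\<lambda>a. Ad G A a Z') ((c \<circ> \<tau>) t) \<circ> tangent_map std_atlas A (c \<circ> \<tau>) t"
    unfolding f_def by (rule tangent_map_compose[OF SI AI m12 m3'])
  also have "tangent_map std_atlas A (c \<circ> \<tau>) t = tangent_map std_atlas A c (\<tau> t) \<circ> tangent_map std_atlas std_atlas \<tau> t"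
    by (rule tangent_map_compose[OF SI SI m1 m2])
  also have "tangent_map std_atlas std_atlas \<tau> t = (\<lambda>h. - h)" using frechet_derivativeI[OF \<tau>d] by (simp add: tangent_map_std)
  finally have "tangent_map std_atlas std_atlas f t 1 = lie_bracket G A (tangent_map std_atlas A c 0 (- 1)) Z'"
    by (simp add: lie_bracket_def \<tau>_def exp_curve(3))
  also have "tangent_map std_atlas A c 0 (- 1) = - X0"
    using velocity_tangent_map[OF exp_curve(5), of 0] linear_neg[OF linear_tangent_map[OF exp_curve(5)], of 0 1] exp_curve(6) by simp
  also have "lie_bracket G A (- X0) Z' = - lie_bracket G A X0 Z'"
    unfolding lie_bracket_def by (rule linear_neg[OF linear_tangent_map[OF mdiff_Ad]])
  finally have "tangent_map std_atlas std_atlas f t 1 = - lie_bracket G A X0 Z'" .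
  then have "coord_deriv (UNIV, id) (UNIV, id) f t 1 = - lie_bracket G A X0 Z'"
    by (simp add: tangent_map_coord chart_at_std)
  with coord_deriv_curve[OF m, of "(UNIV, id)"] have "(f has_vector_derivative - lie_bracket G A X0 Z') (at t)" by simp
  moreover have "f = (\<lambda>s. Ad G A (c (- s)) Z)"
  proof
    fix s
    have "c (- s) = c (t - s) \<otimes> c (- t)" by (simp add: exp_curve(2)[symmetric])
    then show "f s = Ad G A (c (- s)) Z" by (simp add: f_def \<tau>_def Z'_def Ad_mult exp_curve(1))
  qed
  ultimately show ?thesis by (simp add: Z'_def)
qed

end

end


section \<open>Orbits that are geodesics\<close>

lemma all_surj_iff: "surj h \<Longrightarrow> (\<forall>w. Q w) \<longleftrightarrow> (\<forall>z. Q (h z))"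
  by (metis surjD)

context homogeneous_space
begin

lemma base_coset: "H \<in> lcosets\<^bsub>G\<^esub> H"
  using mem_cosets[OF one_closed] proj_one by simp

lemma base_chart: "chart_at B H \<in> B" "H \<in> fst (chart_at B H)"
  using chart_at_mem[OF mB[OF base_coset]] by auto

lemma act_base: "a \<in> carrier G \<Longrightarrow> act_on a H = proj a"
  using act_proj[of a \<one>] by (simp add: proj_one)

text \<open>Both sides are the derivative of \<open>act_on a\<close> from \<open>j\<close> to the
  chart chosen at the image point: one changes charts after acting, the other before.\<close>

lemma tangent_of_coords_act:
  assumes a: "a \<in> carrier G" and j: "j \<in> B" "q \<in> fst j" and k: "k \<in> B" "act_on a q \<in> fst k"
  shows "tangent_of_coords B k (act_on a q) (coord_deriv j k (act_on a) q v) = dact G B a q (tangent_of_coords B j q v)"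
proof -
  have q: "q \<in> lcosets\<^bsub>G\<^esub> H" by (rule chart_cosets[OF j])
  note aq = act_cosets[OF a q]
  have m1: "mdiff B B (act_on a) q" by (rule mdiff_act[OF a q])
  have i1: "mdiff B B id q" and i2: "mdiff B B id (act_on a q)"
    using mdiff_id[OF Y] q aq topY by auto
  define r where "r = chart_at B (act_on a q)"
  define l where "l = chart_at B q"
  have r: "r \<in> B" "act_on a q \<in> fst r" and l: "l \<in> B" "q \<in> fst l"
    unfolding r_def l_def using chart_at_mem[OF mB] q aq by auto
  have i1': "mdiff B B (act_on a) (id q)" using m1 by simp
  have "coord_deriv j r (id \<circ> act_on a) q = coord_deriv k r id (act_on a q) \<circ> coord_deriv j k (act_on a) q"
    by (rule coord_deriv_compose[OF BI BI m1 i2 j k]) (use r in auto)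
  moreover have "coord_deriv j r (act_on a \<circ> id) q = coord_deriv l r (act_on a) (id q) \<circ> coord_deriv j l id q"
    by (rule coord_deriv_compose[OF BI BI i1 i1' j]) (use r l in auto)
  ultimately have "coord_deriv k r id (act_on a q) \<circ> coord_deriv j k (act_on a) q = coord_deriv l r (act_on a) q \<circ> coord_deriv j l id q"
    by simp
  from fun_cong[OF this, of v] show ?thesis
    by (simp add: tangent_of_coords_def chart_change_coord dact_tangent tangent_map_coord r_def l_def)
qed

lemma tangent_of_base_coords: "tangent_of_coords B (chart_at B H) H v = v"
  using coord_deriv_id[OF BY base_chart] by (simp add: tangent_of_coords_def chart_change_coord)

text \<open>Invariance of the metric in the form that \<open>euler_lagrange_symmetry\<close> takes
  as a hypothesis; it also compares the energy along the orbit with the one at the base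
  point.\<close>

lemma chart_energy_act:
  assumes inv: "\<And>a p y. a \<in> carrier G \<Longrightarrow> p \<in> lcosets\<^bsub>G\<^esub> H \<Longrightarrow> N (act_on a p) (dact G B a p y) = N p y"
    and a: "a \<in> carrier G" and j: "j \<in> B" "q \<in> fst j" and k: "k \<in> B" "act_on a q \<in> fst k"
  shows "chart_energy B k N (snd k (act_on a q)) (coord_deriv j k (act_on a) q v) = chart_energy B j N (snd j q) v"
  using tangent_of_coords_act[OF a j k, of v] inv[OF a chart_cosets[OF j]]
  by (simp add: chart_energy_def local_rep_def chart_inv_chart[OF proper_atlasD(3)[OF BY k(1)] k(2)]
      chart_inv_chart[OF proper_atlasD(3)[OF BY j(1)] j(2)])

lemma velocity_orbit:
  assumes c: "is_exp_curve G X A X0 c"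
  shows "velocity B (\<lambda>s. proj (c s)) t = dact G B (c t) H (dproj G A H B X0)"
proof -
  have m: "mdiff std_atlas B (\<lambda>s. proj (c s)) t" by (rule mdiff_orbit_curve[OF c])
  have "proj (c t) \<in> \<Union>(fst ` B)" using m by (simp add: mdiff_def)
  note k = chart_at_mem[OF this]
  show ?thesis
    using orbit_velocity_coord[OF c k] velocity_tangent_map[OF m] act_base[OF exp_curve(1)[OF c], of t]
    by (simp add: tangent_map_coord chart_at_std dact_tangent)
qed

context
  fixes c X0 N
  assumes c: "is_exp_curve G X A X0 c"
    and curve: "smooth_curve Y B (\<lambda>s. proj (c s))"
    and inv: "\<And>a p y. a \<in> carrier G \<Longrightarrow> p \<in> lcosets\<^bsub>G\<^esub> H \<Longrightarrow> N (act_on a p) (dact G B a p y) = N p y"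
    and smooth: "\<And>k. k \<in> B \<Longrightarrow>
      twice_differentiable_on (\<lambda>(x, v). chart_energy B k N x v) ((snd k ` fst k) \<times> - {0})"
begin

text \<open>Everything is pulled back by \<open>S s\<close>, the derivative of
  \<open>act_on (c s)\<close> at the base point, read in \<open>k\<close>. The velocity is
  \<open>S s y0\<close>, the fundamental field is \<open>S s\<close> of the projection of
  \<open>Ad G A (c (- s)) Z\<close>, and by invariance the fibre derivative of the energy on
  \<open>S s u\<close> is the number \<open>P u\<close> for every \<open>s\<close>. The momentum is
  therefore \<open>P\<close> on a vector whose derivative \<open>Ad_curve\<close> supplies. A
  nonzero \<open>y0\<close> keeps the velocity off the zero section, away from which the energy is
  twice differentiable.\<close>

lemma euler_lagrange_orbit:
  assumes k: "k \<in> B" "proj (c t) \<in> fst k" and y0: "dproj G A H B X0 \<noteq> 0"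
  shows "(\<forall>w. ((\<lambda>s. frechet_derivative (chart_energy B k N ((snd k \<circ> (\<lambda>s. proj (c s))) s))
             (at (vector_derivative (snd k \<circ> (\<lambda>s. proj (c s))) (at s))) w) has_real_derivative
           frechet_derivative (\<lambda>z. chart_energy B k N z (vector_derivative (snd k \<circ> (\<lambda>s. proj (c s))) (at t)))
             (at ((snd k \<circ> (\<lambda>s. proj (c s))) t)) w) (at t)) \<longleftrightarrow>
         (\<forall>Z. frechet_derivative (\<lambda>y. 1 / 2 * (N H y)\<^sup>2) (at (dproj G A H B X0)) (dproj G A H B (lie_bracket G A X0 Z)) = 0)"
proof -
  define \<gamma> where "\<gamma> s = proj (c s)" for s
  define x where "x = snd k \<circ> \<gamma>"
  define x' where "x' s = vector_derivative x (at s)" for s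
  define L where "L = chart_energy B k N"
  define L2 where "L2 = (\<lambda>(x, v). L x v)"
  define E where "E y = 1 / 2 * (N H y)\<^sup>2" for y
  define \<sigma> where "\<sigma> = (UNIV :: real set, id :: real \<Rightarrow> real)"
  define J where "J = {s. \<gamma> s \<in> fst k}"
  define h where "h = chart_at B H"
  define S where "S s = coord_deriv h k (act_on (c s)) H" for s
  define y0 where "y0 = dproj G A H B X0"
  define D where "D = (snd k ` fst k) \<times> - {0 :: 'f}"
  note cG = exp_curve(1)[OF c]
  note h = base_chart[folded h_def]
  have \<gamma>s: "\<gamma> s = act_on (c s) H" for s by (simp add: \<gamma>_def act_base cG)
  have \<gamma>c: "\<gamma> s \<in> lcosets\<^bsub>G\<^esub> H" for s by (simp add: \<gamma>_def mem_cosets cG)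
  have tJ: "t \<in> J" using k by (simp add: J_def \<gamma>_def)
  have J_D: "J = snd \<sigma> ` {p \<in> fst \<sigma>. \<gamma> p \<in> fst k}" by (auto simp: J_def \<sigma>_def)
  have sm: "smooth_map euclideanreal std_atlas Y B \<gamma>" using curve by (simp add: smooth_curve_def \<gamma>_def[abs_def])
  have \<sigma>: "\<sigma> \<in> std_atlas" by (simp add: \<sigma>_def)
  have J: "open J" "twice_differentiable_on x J"
    using coord_rep_smooth[OF proper_std_atlas BY sm \<sigma> k(1)] unfolding J_D x_def by (simp_all add: \<sigma>_def chart_inv_std)
  have L2: "twice_differentiable_on L2 D"
    using smooth[OF k(1)] by (simp add: L2_def L_def D_def)
  have openD: "open D"
    unfolding D_def by (intro open_Times proper_atlasD(2)[OF BY k(1)]) auto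
  have x's: "x' s = S s y0 \<and> (x has_vector_derivative x' s) (at s)" if "s \<in> J" for s
  proof -
    have "(x has_vector_derivative coord_deriv \<sigma> k \<gamma> s 1) (at s)"
      using coord_deriv_curve[OF mdiff_orbit_curve[OF c] k(1), of s] that
      by (simp add: x_def \<gamma>_def[abs_def] J_def \<sigma>_def)
    moreover have "coord_deriv \<sigma> k \<gamma> s 1 = S s y0"
      using orbit_velocity_coord[OF c k(1), of s] that
      by (simp add: \<gamma>_def[abs_def] \<sigma>_def S_def h_def y0_def J_def)
    ultimately show ?thesis by (auto simp: x'_def vector_derivative_at)
  qed
  have linS: "linear (S s)" and injS: "inj (S s)" if "s \<in> J" for s
  proof -
    have ks: "act_on (c s) H \<in> fst k" using that by (simp add: J_def \<gamma>s)
    show "linear (S s)"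
      unfolding S_def by (rule linear_coord_deriv[OF mdiff_act[OF cG base_coset] h(1) k(1) h(2) ks])
    show "inj (S s)"
    proof (rule injI)
      fix u v assume "S s u = S s v"
      then have "dact G B (c s) H u = dact G B (c s) H v"
        using tangent_of_coords_act[OF cG h k(1) ks] tangent_of_base_coords unfolding S_def h_def by metis
      then show "u = v" using inj_dact[OF cG base_coset] by (simp add: inj_eq)
    qed
  qed
  have surjS: "surj (S s)" if "s \<in> J" for s
    using linear_injective_imp_surjective[OF linS injS] that by blast
  have zD: "(x s, x' s) \<in> D" if "s \<in> J" for s
  proof -
    have "x' s \<noteq> 0"
      using x's[OF that] y0 injS[OF that] linear_0[OF linS[OF that]] unfolding y0_def by (metis injD)
    then show ?thesis using that by (auto simp: D_def x_def J_def)
  qed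
  have EL: "E u = L (x s) (S s u)" if "s \<in> J" for s u
    using chart_energy_act[OF inv cG h k(1), of s u] that
    by (simp add: E_def L_def S_def J_def x_def \<gamma>s)
       (simp add: chart_energy_def local_rep_def h_def tangent_of_base_coords
          chart_inv_chart[OF proper_atlasD(3)[OF BY base_chart(1)] base_chart(2)])
  have dE: "(E has_derivative (\<lambda>u. frechet_derivative L2 (at (x s, x' s)) (0, S s u))) (at y0)" if "s \<in> J" for s
  proof -
    have d: "((\<lambda>u. (x s, S s u)) has_derivative (\<lambda>u. (0, S s u))) (at y0)"
      by (intro has_derivative_Pair has_derivative_const linear_imp_has_derivative linS that)
    have E: "E = (\<lambda>u. L2 (x s, S s u))" using EL[OF that] by (simp add: L2_def fun_eq_iff)
    show ?thesis
      unfolding E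
      by (rule has_derivative_frechet_chain[OF d _ twice_differentiable_onD(1)[OF L2 zD[OF that]]]) (use x's[OF that] in simp)
  qed
  have Ed: "E differentiable at y0" using dE[OF tJ] by (auto simp: differentiable_def)
  define P where "P u = frechet_derivative E (at y0) u" for u
  have linP: "linear P" unfolding P_def by (rule linear_frechet_derivative[OF Ed])
  have P: "P u = frechet_derivative L2 (at (x s, x' s)) (0, S s u)" if "s \<in> J" for s u
    unfolding P_def using frechet_derivativeI[OF dE[OF that]] by simp

  \<comment> \<open>The action read in the chart of \<open>G\<close> at \<open>\<one>\<close> and
    the chart \<open>k\<close>: the parameter of the local symmetry runs through coordinates of
    group elements near \<open>\<one>\<close>.\<close>
  define kk where "kk = (fst chart1 \<times> fst k, map_prod (snd chart1) (snd k))"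
  define ac where "ac = (\<lambda>(a, S). act_on a S)"
  define \<Phi> where "\<Phi> = snd k \<circ> ac \<circ> chart_inv kk"
  define T where "T = snd kk ` {p \<in> fst kk. ac p \<in> fst k}"
  define e0 where "e0 = snd chart1 \<one>"
  have kkA: "kk \<in> prod_atlas A B" unfolding kk_def by (rule prod_atlasI[OF chart1(1) k(1)])
  note T = coord_rep_smooth[OF AB BY act kkA k(1), folded ac_def, folded T_def \<Phi>_def]
  have kkd: "coord_deriv kk k ac p = frechet_derivative \<Phi> (at (snd chart1 (fst p), snd k (snd p)))" for p
    by (cases p) (simp add: coord_deriv_def \<Phi>_def kk_def)
  have \<Phi>v: "\<Phi> (snd chart1 a, snd k q) = snd k (act_on a q)" if "a \<in> fst chart1" "q \<in> fst k" for a q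
  proof -
    have "chart_inv kk (snd kk (a, q)) = (a, q)"
      by (rule chart_inv_chart[OF proper_atlasD(3)[OF AB kkA]]) (use that in \<open>simp add: kk_def\<close>)
    then show ?thesis by (simp add: \<Phi>_def kk_def ac_def)
  qed
  have memT: "(snd chart1 a, snd k q) \<in> T" if "a \<in> fst chart1" "q \<in> fst k" "act_on a q \<in> fst k" for a q
    unfolding T_def by (rule image_eqI[of _ _ "(a, q)"]) (use that in \<open>auto simp: kk_def ac_def\<close>)
  have \<gamma>1: "act_on \<one> (\<gamma> s) = \<gamma> s" for s by (rule act_one[OF \<gamma>c])
  have eT: "(e0, x s) \<in> T" if "s \<in> J" for s
    unfolding e0_def x_def o_apply by (rule memT[OF chart1(2)]) (use that \<gamma>1 in \<open>auto simp: J_def\<close>)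
  have mac: "mdiff (prod_atlas A B) B ac (a, q)" if "a \<in> carrier G" "q \<in> lcosets\<^bsub>G\<^esub> H" for a q
    unfolding ac_def by (rule mdiff_act2[OF that])
  have W: "frechet_derivative \<Phi> (at (e0, x s)) (Z, 0) = S s (dproj G A H B (Ad G A (c (- s)) Z))" if "s \<in> J" for s Z
  proof -
    have ks: "proj (c s) \<in> fst k" using that by (simp add: J_def \<gamma>_def)
    have m: "ac (\<one>, \<gamma> s) \<in> fst k" using ks \<gamma>1 by (simp add: ac_def \<gamma>_def)
    have "coord_deriv chart1 k (\<lambda>a. ac (a, \<gamma> s)) \<one> Z = frechet_derivative \<Phi> (at (e0, x s)) (Z, 0)"
      using coord_deriv_partial(1)[OF X Y mac chart1 k(1) _ k(1) m, folded kk_def, unfolded kkd, of Z] \<gamma>c ks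
      by (simp add: e0_def x_def \<gamma>_def)
    moreover have "(\<lambda>a. ac (a, \<gamma> s)) = (\<lambda>b. act_on b (proj (c s)))" by (simp add: ac_def \<gamma>_def)
    ultimately show ?thesis
      using killing_coord[OF cG k(1) ks, of Z] by (simp add: S_def h_def exp_curve(4)[OF c])
  qed
  \<comment> \<open>For \<open>e\<close> near \<open>e0\<close> the corresponding group element
    keeps \<open>\<gamma> t\<close> in the domain of \<open>k\<close>, so both energies are read in
    the same chart.\<close>
  have inv': "\<forall>\<^sub>F e in nhds e0. L2 (\<Phi> (e, x t), frechet_derivative \<Phi> (at (e, x t)) (0, x' t)) = L2 (x t, x' t)"
  proof -
    have "mdiff A B (\<lambda>a. act_on a (\<gamma> t)) \<one>" by (rule mdiff_orbit[OF one_closed \<gamma>c])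
    from mdiffD[OF this chart1(1) k(1) chart1(2)] have "\<forall>\<^sub>F e in nhds e0. act_on (chart_inv chart1 e) (\<gamma> t) \<in> fst k"
      using k \<gamma>1 by (simp add: coord_diff_at_def e0_def \<gamma>_def)
    moreover have "\<forall>\<^sub>F e in nhds e0. e \<in> snd chart1 ` fst chart1"
      using chart1 by (simp add: e0_def eventually_nhds_in_open proper_atlasD(2)[OF AX])
    ultimately show ?thesis
    proof eventually_elim
      case (elim e)
      define a where "a = chart_inv chart1 e"
      have a: "a \<in> fst chart1" "snd chart1 a = e" "act_on a (\<gamma> t) \<in> fst k"
        using elim chart_chart_inv[of e chart1] by (auto simp: a_def)
      have aG: "a \<in> carrier G" using chart_carrier[OF chart1(1) a(1)] .
      have kt: "\<gamma> t \<in> fst k" using tJ by (simp add: J_def)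
      have m: "ac (a, \<gamma> t) \<in> fst k" using a by (simp add: ac_def)
      have "coord_deriv k k (\<lambda>q. ac (a, q)) (\<gamma> t) v = frechet_derivative \<Phi> (at (e, x t)) (0, v)" for v
        using coord_deriv_partial(2)[OF X Y mac[OF aG \<gamma>c] chart1(1) a(1) k(1) kt k(1) m, folded kk_def, unfolded kkd, of v]
        by (simp add: x_def a)
      moreover have "(\<lambda>q. ac (a, q)) = act_on a" by (simp add: ac_def)
      ultimately show ?case
        using chart_energy_act[OF inv aG k(1) kt k(1) a(3), of "x' t"] \<Phi>v[OF a(1) kt]
        by (simp add: L2_def L_def x_def a)
    qed
  qed
  have id: "\<forall>\<^sub>F y in nhds (x t). \<Phi> (e0, y) = y"
  proof (rule eventually_mono)
    show "\<forall>\<^sub>F y in nhds (x t). y \<in> snd k ` fst k"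
      using tJ by (intro eventually_nhds_in_open proper_atlasD(2)[OF BY k(1)]) (auto simp: x_def J_def)
    show "\<Phi> (e0, y) = y" if "y \<in> snd k ` fst k" for y
      using that \<Phi>v[OF chart1(2)] act_one[OF chart_cosets[OF k(1)]] by (auto simp: e0_def)
  qed
  have evJ: "\<forall>\<^sub>F s in nhds t. s \<in> J" by (rule eventually_nhds_in_open[OF J(1) tJ])
  \<comment> \<open>Near \<open>t\<close>, \<open>x'\<close> agrees with
    \<open>frechet_derivative x (at s) 1\<close>, which is differentiable because \<open>x\<close>
    is twice differentiable.\<close>
  obtain b where x'd: "(x' has_vector_derivative b) (at t)"
  proof -
    have "\<forall>\<^sub>F s in nhds t. frechet_derivative x (at s) 1 = x' s"
      using evJ
    proof eventually_elim
      case (elim s)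
      then show ?case
        using frechet_derivativeI[OF conjunct2[OF x's[OF elim], unfolded has_vector_derivative_def]] by simp
    qed
    from differentiable_eventually_cong(1)[OF twice_differentiable_onD(2)[OF J(2) tJ] this]
    have "x' differentiable at t" .
    then show ?thesis using that vector_derivative_works by blast
  qed
  obtain q where q: "linear q"
      "\<And>w. ((\<lambda>s. frechet_derivative L2 (at (x s, x' s)) (0, w)) has_real_derivative q w) (at t)"
      "\<And>Z. ((\<lambda>s. frechet_derivative L2 (at (x s, x' s)) (0, frechet_derivative \<Phi> (at (e0, x s)) (Z, 0)))
       has_real_derivative
         (q (frechet_derivative \<Phi> (at (e0, x t)) (Z, 0))
          - frechet_derivative L2 (at (x t, x' t)) (frechet_derivative \<Phi> (at (e0, x t)) (Z, 0), 0))) (at t)"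
    using euler_lagrange_symmetry[where x=x and x'=x' and t=t and L=L2 and \<Phi>=\<Phi> and ?e0.0=e0,
        OF openD zD[OF tJ] L2 T(1) eT[OF tJ] T(2) conjunct2[OF x's[OF tJ]] x'd inv' id] by blast

  \<comment> \<open>To test on \<open>Z\<close> at time \<open>t\<close>, take the momentum of
    \<open>Z0\<close> with \<open>Ad G A (c (- t)) Z0 = Z\<close>. Its derivative at
    \<open>t\<close> is computed twice, by the symmetry lemma and by \<open>Ad_curve\<close>, and
    the results are compared.\<close>
  have defect: "q (S t (dproj G A H B Z)) - frechet_derivative L2 (at (x t, x' t)) (S t (dproj G A H B Z), 0)
      = - P (dproj G A H B (lie_bracket G A X0 Z))" for Z
  proof -
    obtain Z0 where Z0: "Z = Ad G A (c (- t)) Z0" using surj_Ad[OF cG, of "- t"] by (metis surjD)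
    have "linear (\<lambda>V. P (dproj G A H B V))" using linear_compose[OF linear_dproj linP] by (simp add: o_def)
    then have "bounded_linear (\<lambda>V. P (dproj G A H B V))" by (simp add: linear_conv_bounded_linear)
    from bounded_linear.has_vector_derivative[OF this Ad_curve[OF c, of Z0 t]]
    have "((\<lambda>s. P (dproj G A H B (Ad G A (c (- s)) Z0))) has_real_derivative
        P (dproj G A H B (- lie_bracket G A X0 Z))) (at t)"
      by (simp add: has_real_derivative_iff_has_vector_derivative Z0)
    moreover have "\<forall>\<^sub>F s in nhds t. P (dproj G A H B (Ad G A (c (- s)) Z0)) =
        frechet_derivative L2 (at (x s, x' s)) (0, frechet_derivative \<Phi> (at (e0, x s)) (Z0, 0))"
      using evJ by eventually_elim (simp add: P W)
    ultimately have "((\<lambda>s. frechet_derivative L2 (at (x s, x' s)) (0, frechet_derivative \<Phi> (at (e0, x s)) (Z0, 0)))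
        has_real_derivative P (dproj G A H B (- lie_bracket G A X0 Z))) (at t)"
      by (rule DERIV_eventually_cong)
    from DERIV_unique[OF this q(3)] show ?thesis
      by (simp add: W[OF tJ] Z0 linear_neg[OF linear_dproj] linear_neg[OF linP])
  qed
  have defect0: "frechet_derivative L2 (at (x t, x' t)) (S t (dproj G A H B Z), 0) = q (S t (dproj G A H B Z)) \<longleftrightarrow>
      P (dproj G A H B (lie_bracket G A X0 Z)) = 0" for Z
    using defect[of Z] by auto
  \<comment> \<open>The projection is a submersion at \<open>\<one>\<close> and \<open>S t\<close>
    is onto, so the fundamental fields reach every direction in the chart.\<close>
  have surj: "surj (\<lambda>Z. S t (dproj G A H B Z))"
    using comp_surj[OF _ surjS[OF tJ], of "dproj G A H B"] proj_surj[OF one_closed]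
    by (simp add: o_def dproj_tangent)
  have ev2: "\<forall>\<^sub>F s in nhds t. frechet_derivative (L (x s)) (at (x' s)) w = frechet_derivative L2 (at (x s, x' s)) (0, w)" for w
    using evJ
  proof eventually_elim
    case (elim s)
    show ?case using partial_frechet(1)[OF twice_differentiable_onD(1)[OF L2 zD[OF elim]], of w] by (simp add: L2_def)
  qed
  have Dx: "frechet_derivative (\<lambda>z. L z (x' t)) (at (x t)) w = frechet_derivative L2 (at (x t, x' t)) (w, 0)" for w
    using partial_frechet(2)[OF twice_differentiable_onD(1)[OF L2 zD[OF tJ]], of w] by (simp add: L2_def)
  have "((\<lambda>s. frechet_derivative (L (x s)) (at (x' s)) w) has_real_derivative r) (at t) \<longleftrightarrow> r = q w" for w r
    unfolding DERIV_cong_ev[OF refl ev2 refl] using q(2)[of w] DERIV_unique by blast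
  then have "(\<forall>w. ((\<lambda>s. frechet_derivative (L (x s)) (at (x' s)) w) has_real_derivative
      frechet_derivative (\<lambda>z. L z (x' t)) (at (x t)) w) (at t)) \<longleftrightarrow>
      (\<forall>w. frechet_derivative L2 (at (x t, x' t)) (w, 0) = q w)"
    by (simp add: Dx)
  also have "\<dots> \<longleftrightarrow> (\<forall>Z. frechet_derivative L2 (at (x t, x' t)) (S t (dproj G A H B Z), 0) = q (S t (dproj G A H B Z)))"
    by (rule all_surj_iff[OF surj])
  also have "\<dots> \<longleftrightarrow> (\<forall>Z. P (dproj G A H B (lie_bracket G A X0 Z)) = 0)"
    by (simp add: defect0)
  finally show ?thesis
    unfolding L_def x_def x'_def P_def y0_def \<gamma>_def E_def by (simp add: o_def)
qed

lemma geodesic_orbit_iff: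
  "geodesic Y B N (\<lambda>s. proj (c s)) \<longleftrightarrow> dproj G A H B X0 \<noteq> 0 \<and>
     (\<forall>Z. frechet_derivative (\<lambda>y. 1 / 2 * (N H y)\<^sup>2) (at (dproj G A H B X0)) (dproj G A H B (lie_bracket G A X0 Z)) = 0)"
proof -
  have vel: "velocity B (\<lambda>s. proj (c s)) t \<noteq> 0 \<longleftrightarrow> dproj G A H B X0 \<noteq> 0" for t
  proof -
    have "dact G B (c t) H 0 = 0"
      unfolding dact_tangent by (rule linear_0[OF linear_tangent_map[OF mdiff_act[OF exp_curve(1)[OF c] base_coset]]])
    then show ?thesis
      unfolding velocity_orbit[OF c] using inj_dact[OF exp_curve(1)[OF c] base_coset, of t] by (metis injD)
  qed
  \<comment> \<open>The algebraic condition mentions neither time nor chart: one chart around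
    \<open>proj (c 0)\<close> yields it, and it yields the equation at all times in all
    charts.\<close>
  obtain k where k: "k \<in> B" "proj (c 0) \<in> fst k"
    using mB[OF mem_cosets[OF exp_curve(1)[OF c]]] by blast
  show ?thesis
    unfolding geodesic_def Let_def vel
    using curve euler_lagrange_orbit k by blast
qed

end

end


section \<open>The energy of the metric at the base point\<close>

lemma direct_sumE:
  assumes "direct_sum W P Q" "x \<in> W"
  obtains u v where "x = u + v" "u \<in> P" "v \<in> Q"
  using assms unfolding direct_sum_def by blast

lemma comp_along_sum:
  assumes "direct_sum W P Q" "u \<in> P" "v \<in> Q"
  shows "comp_along P Q (u + v) = u" "comp_along Q P (u + v) = v"
proof -
  have PQ: "subspace P" "subspace Q" "P \<inter> Q = {0}" using assms by (auto simp: direct_sum_def)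
  have *: "x = u" if "x \<in> P" "u + v - x \<in> Q" for x
  proof -
    have "u - x = (u + v - x) - v" by simp
    then have "u - x \<in> P \<inter> Q" using that assms PQ by (metis IntI subspace_diff)
    then show ?thesis using PQ by simp
  qed
  have **: "x = v" if "x \<in> Q" "u + v - x \<in> P" for x
  proof -
    have "v - x = (u + v - x) - u" by simp
    then have "v - x \<in> P \<inter> Q" using that assms PQ by (metis IntI subspace_diff)
    then show ?thesis using PQ by simp
  qed
  show "comp_along P Q (u + v) = u" "comp_along Q P (u + v) = v"
    unfolding comp_along_def using assms * ** by (auto intro!: the_equality)
qed

lemma bilinear_expand:
  fixes f :: "'a::euclidean_space \<Rightarrow> 'a \<Rightarrow> real"
  assumes "bilinear f"
  shows "f u v = (\<Sum>i\<in>Basis. \<Sum>j\<in>Basis. (u \<bullet> i) * ((v \<bullet> j) * f i j))"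
proof -
  have "f (\<Sum>i\<in>Basis. (u \<bullet> i) *\<^sub>R i) (\<Sum>j\<in>Basis. (v \<bullet> j) *\<^sub>R j) =
      (\<Sum>(i, j)\<in>Basis \<times> Basis. f ((u \<bullet> i) *\<^sub>R i) ((v \<bullet> j) *\<^sub>R j))"
    by (rule bilinear_sum[OF assms])
  then show ?thesis
    by (simp add: euclidean_representation sum.cartesian_product bilinear_lmul[OF assms] bilinear_rmul[OF assms] mult.left_commute)
qed

lemma DERIV_along_line:
  fixes E :: "'a::real_normed_vector \<Rightarrow> real"
  assumes "E differentiable at y" "((\<lambda>t. E (y + t *\<^sub>R u)) has_real_derivative D) (at 0)"
  shows "frechet_derivative E (at y) u = D"
proof -
  have "((\<lambda>t. y + t *\<^sub>R u) has_vector_derivative u) (at 0)"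
    by (auto intro!: derivative_eq_intros simp: has_vector_derivative_def)
  from has_vector_derivative_frechet_chain[OF this, of y E] assms
  show ?thesis by (auto simp: has_real_derivative_iff_has_vector_derivative intro: vector_derivative_unique_at)
qed

text \<open>Both \<open>y1\<close> and \<open>u\<close> are orthogonal to \<open>y2\<close>, so
  along the line the numerator in the argument of \<open>\<phi>\<close> is constant and the energy
  depends on \<open>t\<close> only through \<open>q t\<close>, the squared length, with derivative
  \<open>2 * g y u\<close> at 0. Hence a single factor times \<open>g y u\<close>.\<close>

lemma DERIV_alpha12_energy:
  fixes g :: "'f::euclidean_space \<Rightarrow> 'f \<Rightarrow> real" and \<phi> :: "real \<Rightarrow> real"
  assumes g: "bilinear g" "\<And>u v. g u v = g v u" "\<forall>u. u \<noteq> 0 \<longrightarrow> g u u > 0"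
    and orth: "g y1 y2 = 0" "g u y2 = 0"
    and \<phi>: "\<phi> differentiable_on {0..1}"
    and y: "y = y1 + y2" "y \<noteq> 0" and b: "b = sqrt (g y2 y2) / sqrt (g y y)"
  shows "((\<lambda>t. 1 / 2 * (sqrt (g (y + t *\<^sub>R u) (y + t *\<^sub>R u)) *
      \<phi> (sqrt (g y2 y2) / sqrt (g (y + t *\<^sub>R u) (y + t *\<^sub>R u))))\<^sup>2) has_real_derivative
      ((\<phi> b)\<^sup>2 - \<phi> b * deriv01 \<phi> b * b) * g y u) (at 0)"
proof -
  note bl = bilinear_ladd[OF g(1)] bilinear_radd[OF g(1)] bilinear_lmul[OF g(1)] bilinear_rmul[OF g(1)]
  have pos: "g v v \<ge> 0" for v using g(3)[rule_format, of v] bilinear_lzero[OF g(1)] by (cases "v = 0") auto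
  define q where "q t = g (y + t *\<^sub>R u) (y + t *\<^sub>R u)" for t
  define \<beta> where "\<beta> = sqrt (g y2 y2)"
  define s where "s t = \<beta> / sqrt (q t)" for t
  have q_eq: "q t = g y y + 2 * t * g y u + t * t * g u u" for t
    unfolding q_def using g(2)[of u y] by (simp add: bl algebra_simps)
  have q0: "q 0 = g y y" "q 0 > 0" using g(3)[rule_format, OF y(2)] by (simp_all add: q_def)
  have dq: "(q has_real_derivative 2 * g y u) (at 0)"
    unfolding q_eq[abs_def] by (auto intro!: derivative_eq_intros)
  have "q t = g (y1 + t *\<^sub>R u) (y1 + t *\<^sub>R u) + g y2 y2" for t
    unfolding q_def y(1) using orth g(2)[of y2 y1] g(2)[of y2 u] by (simp add: bl algebra_simps)
  then have le: "g y2 y2 \<le> q t" for t using pos by simp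
  \<comment> \<open>\<open>\<phi>\<close> is differentiable within \<open>{0..1}\<close>. The chain
    rule needs a derivative within the range of \<open>s\<close>, which stays in this interval even
    if \<open>b\<close> is an end point.\<close>
  have s01: "s t \<in> {0..1}" for t
    using le[of t] pos[of y2] by (auto simp: s_def \<beta>_def divide_le_eq_1 zero_le_divide_iff)
  have s0: "s 0 = b" by (simp add: s_def b \<beta>_def q0)
  \<comment> \<open>From s = \<beta> q^(-1/2): the derivative is - s q' / (2 q), with q' = 2 g(y, u)
    at 0.\<close>
  define s' where "s' = - (b * g y u / q 0)"
  have ds: "(s has_real_derivative s') (at 0)"
    unfolding s_def[abs_def] s'_def b using q0
    by (auto intro!: derivative_eq_intros dq simp: \<beta>_def power2_eq_square field_simps)
  have "(\<phi> has_vector_derivative deriv01 \<phi> b) (at b within {0..1})"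
    unfolding deriv01_def using \<phi> s01[of 0] s0 by (simp add: differentiable_on_def vector_derivative_works[symmetric])
  then have "(\<phi> has_real_derivative deriv01 \<phi> b) (at (s 0) within range s)"
    unfolding s0 has_real_derivative_iff_has_vector_derivative
    by (rule has_vector_derivative_within_subset) (use s01 in auto)
  from DERIV_image_chain[OF this ds]
  have d\<phi>: "((\<lambda>t. \<phi> (s t)) has_real_derivative deriv01 \<phi> b * s') (at 0)" by (simp add: o_def)
  have "((\<lambda>t. 1 / 2 * (q t * (\<phi> (s t))\<^sup>2)) has_real_derivative
      ((\<phi> b)\<^sup>2 - \<phi> b * deriv01 \<phi> b * b) * g y u) (at 0)"
    using q0 by (auto intro!: derivative_eq_intros dq d\<phi> simp: s0 s'_def field_simps power2_eq_square)
  moreover have "1 / 2 * (q t * (\<phi> (s t))\<^sup>2) = 1 / 2 * (sqrt (q t) * \<phi> (\<beta> / sqrt (q t)))\<^sup>2" for t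
    using pos[of "y + t *\<^sub>R u"] by (simp add: power_mult_distrib s_def q_def)
  ultimately show ?thesis unfolding q_def \<beta>_def by simp
qed

section \<open>Regularity and derivatives of the two energies\<close>

context homogeneous_space
begin

text \<open>A one-parameter subgroup inside \<open>H\<close> fixes the coset \<open>H\<close>, so
  its orbit is constant and has velocity 0.\<close>

lemma dproj_subalgebra:
  assumes "U \<in> subgroup_lie_algebra G X A H"
  shows "dproj G A H B U = 0"
proof -
  obtain c where c: "is_exp_curve G X A U c" "\<And>t. c t \<in> H"
    using assms by (auto simp: subgroup_lie_algebra_def)
  have "proj (c t) = H" for t
    unfolding proj_def using coset_join3[OF exp_curve(1)[OF c(1)] subgroup c(2)] .
  then have "velocity B (\<lambda>s. proj (c s)) 0 = 0"
    by (simp add: velocity_def o_def)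
  then show ?thesis
    using velocity_orbit[OF c(1), of 0] dact_one[OF base_coset] exp_curve(3)[OF c(1)] by simp
qed

lemma finsler_energy_smooth:
  assumes F: "finsler_metric Y B F" and k: "k \<in> B"
  shows "twice_differentiable_on (\<lambda>(x, v). chart_energy B k F x v) ((snd k ` fst k) \<times> - {0})"
proof -
  have op: "open ((snd k ` fst k) \<times> - {0 :: 'f})"
    by (intro open_Times proper_atlasD(2)[OF BY k]) auto
  have "smooth_on ((snd k ` fst k) \<times> - {0}) (\<lambda>(x, v). local_rep B k F x v)"
    using F k unfolding finsler_metric_def by (cases k) auto
  from smooth_on_imp_twice_differentiable_on[OF this op]
  have l: "twice_differentiable_on (\<lambda>(x, v). local_rep B k F x v) ((snd k ` fst k) \<times> - {0})" .
  show ?thesis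
    using twice_differentiable_on_mult[OF op twice_differentiable_on_const[OF op, of "1/2"] twice_differentiable_on_mult[OF op l l]]
    by (simp add: chart_energy_def power2_eq_square case_prod_unfold)
qed

lemma linear_tangent_of_coords:
  assumes k: "k \<in> B" "p \<in> fst k" shows "linear (tangent_of_coords B k p)"
proof -
  have p: "p \<in> lcosets\<^bsub>G\<^esub> H" by (rule chart_cosets[OF k])
  have "mdiff B B id p" using mdiff_id[OF Y] p topY by simp
  from linear_coord_deriv[OF this k(1) _ k(2)] chart_at_mem[OF mB[OF p]]
  show ?thesis by (simp add: tangent_of_coords_def chart_change_coord)
qed

text \<open>\<open>riemannian_metric\<close> gives smooth coefficients for fixed vectors;
  \<open>bilinear_expand\<close> makes the energy a quadratic polynomial in the fibre variable with
  these coefficients.\<close>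

lemma riemannian_energy_smooth:
  assumes g: "riemannian_metric Y B g" and k: "k \<in> B"
  shows "twice_differentiable_on (\<lambda>(x, v). chart_energy B k (riem_norm g) x v) ((snd k ` fst k) \<times> - {0})"
proof -
  define D where "D = (snd k ` fst k) \<times> - {0 :: 'f}"
  have opk: "open (snd k ` fst k)" by (rule proper_atlasD(2)[OF BY k])
  have op: "open D" unfolding D_def by (intro open_Times opk) auto
  define m where "m x i j = g (chart_inv k x) (tangent_of_coords B k (chart_inv k x) i) (tangent_of_coords B k (chart_inv k x) j)"
    for x i j
  have "smooth_on (snd k ` fst k) (\<lambda>x. m x i j)" for i j
    using g k unfolding riemannian_metric_def m_def Let_def by (cases k) auto
  from smooth_on_imp_twice_differentiable_on[OF this opk]
  have m: "twice_differentiable_on (\<lambda>z. m (fst z) i j) D" for i j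
    by (rule twice_differentiable_on_compose_linear[OF opk op bounded_linear_fst, rotated])
       (auto simp: D_def)
  have c: "twice_differentiable_on (\<lambda>z. snd z \<bullet> i) D" for i
    by (rule twice_differentiable_on_linear[OF _ op])
       (rule bounded_linear_compose[OF bounded_linear_inner_left bounded_linear_snd])
  have "twice_differentiable_on (\<lambda>z. 1 / 2 * (\<Sum>i\<in>Basis. \<Sum>j\<in>Basis. (snd z \<bullet> i) * ((snd z \<bullet> j) * m (fst z) i j))) D"
    by (intro twice_differentiable_on_mult twice_differentiable_on_sum twice_differentiable_on_const op finite_Basis m c)
  then have "twice_differentiable_on (\<lambda>(x, v). chart_energy B k (riem_norm g) x v) D"
  proof (rule twice_differentiable_on_cong[OF op])
    fix z assume "z \<in> D"
    then have p: "chart_inv k (fst z) \<in> fst k" by (auto simp: D_def chart_chart_inv)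
    define p where "p = chart_inv k (fst z)"
    define T where "T = tangent_of_coords B k p"
    have pY: "p \<in> topspace Y" using proper_atlasD(5)[OF BY k p] by (simp add: p_def)
    have lT: "linear T" unfolding T_def p_def by (rule linear_tangent_of_coords[OF k p])
    have bg: "bilinear (g p)" and pos: "\<And>u. u \<noteq> 0 \<Longrightarrow> g p u u > 0"
      using g pY by (auto simp: riemannian_metric_def)
    have pos: "g p u u \<ge> 0" for u using pos[of u] bilinear_lzero[OF bg] by (cases "u = 0") auto
    have "bilinear (\<lambda>u v. g p (T u) (T v))"
      using bg lT unfolding bilinear_def linear_iff by auto
    from bilinear_expand[OF this, of "snd z" "snd z"]
    have "1 / 2 * (\<Sum>i\<in>Basis. \<Sum>j\<in>Basis. (snd z \<bullet> i) * ((snd z \<bullet> j) * m (fst z) i j)) = 1 / 2 * g p (T (snd z)) (T (snd z))"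
      by (simp add: m_def p_def[symmetric] T_def[symmetric])
    also have "\<dots> = (case z of (x, v) \<Rightarrow> chart_energy B k (riem_norm g) x v)"
      using pos[of "T (snd z)"]
      by (simp add: case_prod_unfold chart_energy_def local_rep_def riem_norm_def p_def[symmetric] T_def[symmetric])
    finally show "1 / 2 * (\<Sum>i\<in>Basis. \<Sum>j\<in>Basis. (snd z \<bullet> i) * ((snd z \<bullet> j) * m (fst z) i j)) = (case z of (x, v) \<Rightarrow> chart_energy B k (riem_norm g) x v)" .
  qed
  then show ?thesis by (simp add: D_def)
qed

lemma energy_differentiable:
  assumes "\<And>k. k \<in> B \<Longrightarrow> twice_differentiable_on (\<lambda>(x, v). chart_energy B k N x v) ((snd k ` fst k) \<times> - {0})" "y \<noteq> 0"
  shows "(\<lambda>y. 1 / 2 * (N H y)\<^sup>2) differentiable at y"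
proof -
  define h where "h = chart_at B H"
  have "(\<lambda>(x, v). chart_energy B h N x v) differentiable at (snd h H, y)"
    using assms(2) base_chart unfolding h_def by (intro twice_differentiable_onD(1)[OF assms(1)]) auto
  moreover have "(\<lambda>v. (snd h H, v)) differentiable at y" by (intro differentiableI[of _ "\<lambda>v. (0, v)"]) (auto intro!: derivative_eq_intros)
  ultimately have "(\<lambda>v. chart_energy B h N (snd h H) v) differentiable at y"
    using differentiable_frechet_chain[of "\<lambda>v. (snd h H, v)" y "\<lambda>(x, v). chart_energy B h N x v"] by simp
  moreover have "chart_energy B h N (snd h H) v = 1 / 2 * (N H v)\<^sup>2" for v
    by (simp add: chart_energy_def local_rep_def h_def tangent_of_base_coords
          chart_inv_chart[OF proper_atlasD(3)[OF BY base_chart(1)] base_chart(2)])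
  ultimately show ?thesis by simp
qed

text \<open>Moving in a direction of \<open>V1 H\<close> fixes the component in \<open>V2 H\<close>,
  so both derivatives are computed along a line; differentiability of the energies makes this the
  value of the Frechet derivative.\<close>

lemma energy_derivative:
  assumes al: "alpha12_metric Y B F g V1 V2 \<phi>" and y: "y \<noteq> 0" and u: "u \<in> V1 H"
  defines "b \<equiv> riem_norm g H (comp_along (V2 H) (V1 H) y) / riem_norm g H y"
  shows "frechet_derivative (\<lambda>y. 1 / 2 * (F H y)\<^sup>2) (at y) u = ((\<phi> b)\<^sup>2 - \<phi> b * deriv01 \<phi> b * b) * g H y u"
    and "frechet_derivative (\<lambda>y. 1 / 2 * (riem_norm g H y)\<^sup>2) (at y) u = g H y u"
proof -
  have HY: "H \<in> topspace Y" using base_coset topY by simp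
  have fin: "finsler_metric Y B F" and rie: "riemannian_metric Y B g"
    and orth: "orthogonal_bundle_decomposition Y B g V1 V2" and sm: "smooth_on {0..1} \<phi>"
    and F: "\<And>y. y \<noteq> 0 \<Longrightarrow> F H y = riem_norm g H y * \<phi> (riem_norm g H (comp_along (V2 H) (V1 H) y) / riem_norm g H y)"
    using al HY unfolding alpha12_metric_def Let_def by auto
  have g: "bilinear (g H)" "\<And>u v. g H u v = g H v u" "\<forall>u. u \<noteq> 0 \<longrightarrow> g H u u > 0"
    using rie HY unfolding riemannian_metric_def by blast+
  have ds: "direct_sum UNIV (V1 H) (V2 H)" and o: "\<And>u v. u \<in> V1 H \<Longrightarrow> v \<in> V2 H \<Longrightarrow> g H u v = 0"
    using orth HY unfolding orthogonal_bundle_decomposition_def by auto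
  have sub: "subspace (V1 H)" using ds by (simp add: direct_sum_def)
  obtain y1 y2 where yy: "y = y1 + y2" "y1 \<in> V1 H" "y2 \<in> V2 H"
    by (rule direct_sumE[OF ds UNIV_I])
  have comp: "comp_along (V2 H) (V1 H) (y + t *\<^sub>R u) = y2" for t
    using comp_along_sum(2)[OF ds, of "y1 + t *\<^sub>R u" y2] yy u sub
    by (simp add: subspace_add subspace_scale algebra_simps)
  have \<phi>d: "\<phi> differentiable_on {0..1}" using sm unfolding smooth_on_def by (metis Ck_on.simps(2))
  have b: "b = sqrt (g H y2 y2) / sqrt (g H y y)" using comp[of 0] by (simp add: b_def riem_norm_def)
  note D = DERIV_alpha12_energy[where g="g H" and u=u, OF g o[OF yy(2,3)] o[OF u yy(3)] _ yy(1) y b]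
  \<comment> \<open>\<open>alpha12_metric\<close> gives the formula for \<open>F\<close> at nonzero
    vectors only; the line avoids 0 near \<open>t = 0\<close>.\<close>
  have ev: "\<forall>\<^sub>F t in nhds 0. y + t *\<^sub>R u \<noteq> 0"
  proof -
    have "((\<lambda>t. y + t *\<^sub>R u) \<longlongrightarrow> y + 0 *\<^sub>R u) (nhds 0)" by (intro tendsto_intros filterlim_ident)
    then show ?thesis using y by (simp add: tendsto_imp_eventually_ne)
  qed
  show "frechet_derivative (\<lambda>y. 1 / 2 * (F H y)\<^sup>2) (at y) u = ((\<phi> b)\<^sup>2 - \<phi> b * deriv01 \<phi> b * b) * g H y u"
  proof (rule DERIV_along_line[OF energy_differentiable[OF finsler_energy_smooth[OF fin] y]])
    show "((\<lambda>t. 1 / 2 * (F H (y + t *\<^sub>R u))\<^sup>2) has_real_derivative ((\<phi> b)\<^sup>2 - \<phi> b * deriv01 \<phi> b * b) * g H y u) (at 0)"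
      by (rule DERIV_eventually_cong[OF D[OF \<phi>d]], rule eventually_mono[OF ev])
         (simp add: F comp riem_norm_def)
  qed
  show "frechet_derivative (\<lambda>y. 1 / 2 * (riem_norm g H y)\<^sup>2) (at y) u = g H y u"
  proof (rule DERIV_along_line[OF energy_differentiable[OF riemannian_energy_smooth[OF rie] y]])
    have sq: "(riem_norm g H v)\<^sup>2 = g H v v" for v
      using g(3)[rule_format, of v] bilinear_lzero[OF g(1)] by (cases "v = 0") (auto simp: riem_norm_def)
    have "1 / 2 * (riem_norm g H (y + t *\<^sub>R u))\<^sup>2 = 1 / 2 * (g H y y + 2 * t * g H y u + t * t * g H u u)" for t
      using g(2)[of u y]
      by (simp add: sq bilinear_ladd[OF g(1)] bilinear_radd[OF g(1)] bilinear_lmul[OF g(1)] bilinear_rmul[OF g(1)] algebra_simps)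
    then show "((\<lambda>t. 1 / 2 * (riem_norm g H (y + t *\<^sub>R u))\<^sup>2) has_real_derivative g H y u) (at 0)"
      by (auto intro!: derivative_eq_intros)
  qed
qed

end

theorem proposition3p4:
  fixes G :: "'g monoid"
    and X\<^sub>G :: "'g topology" and A :: "('g, 'e::euclidean_space) chart set"
    and H :: "'g set"
    and X\<^sub>M :: "'g set topology" and B :: "('g set, 'f::euclidean_space) chart set"
    and F :: "'g set \<Rightarrow> 'f \<Rightarrow> real" and g :: "'g set \<Rightarrow> 'f \<Rightarrow> 'f \<Rightarrow> real"
    and V1 V2 :: "'g set \<Rightarrow> 'f set" and \<phi> :: "real \<Rightarrow> real"
    and \<hh> \<mm> \<mm>1 \<mm>2 :: "'e set" and X :: 'e
  assumes "homogeneous_manifold G X\<^sub>G A H X\<^sub>M B"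
    and "\<hh> = subgroup_lie_algebra G X\<^sub>G A H"
    and "reductive_decomposition G X\<^sub>G A H \<mm>"
    and "alpha12_metric X\<^sub>M B F g V1 V2 \<phi>"
    and "invariant_finsler G H B F" and "invariant_riemannian G H B g"
    and "invariant_subbundle G H B V1" and "invariant_subbundle G H B V2"
    and "direct_sum \<mm> \<mm>1 \<mm>2"
    and "Ad_invariant G A H \<mm>1" and "Ad_invariant G A H \<mm>2"
    and "dproj G A H B ` \<mm>1 = V1 H" and "dproj G A H B ` \<mm>2 = V2 H"
    and "derived_algebra G A \<subseteq> {u + v | u v. u \<in> \<hh> \<and> v \<in> \<mm>1}"
    and "X \<noteq> 0"
  shows "(geodesic_vector G X\<^sub>G A H X\<^sub>M B \<mm> (riem_norm g) X \<longrightarrow>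
            geodesic_vector G X\<^sub>G A H X\<^sub>M B \<mm> F X) \<and>
         (let X\<^sub>\<mm> = comp_along \<mm> \<hh> X;
              X\<^sub>\<mm>\<^sub>2 = comp_along \<mm>2 \<mm>1 X\<^sub>\<mm>;
              nrm = (\<lambda>Y. riem_norm g H (dproj G A H B Y));
              b = nrm X\<^sub>\<mm>\<^sub>2 / nrm X\<^sub>\<mm>
          in geodesic_vector G X\<^sub>G A H X\<^sub>M B \<mm> F X \<longrightarrow>
             (\<phi> b)\<^sup>2 - \<phi> b * deriv01 \<phi> b * b \<noteq> 0 \<longrightarrow>
             deriv01 (deriv01 \<phi>) b \<le> 0 \<longrightarrow>
             geodesic_vector G X\<^sub>G A H X\<^sub>M B \<mm> (riem_norm g) X)"
proof -
  interpret homogeneous_space G X\<^sub>G A H X\<^sub>M B by unfold_locales (rule assms(1))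
  note \<hh> = assms(2) and al = assms(4)
  have fin: "finsler_metric X\<^sub>M B F" and rie: "riemannian_metric X\<^sub>M B g"
    and orth: "orthogonal_bundle_decomposition X\<^sub>M B g V1 V2"
    using al unfolding alpha12_metric_def by auto
  have ds: "direct_sum UNIV (V1 H) (V2 H)"
    using orth base_coset topY unfolding orthogonal_bundle_decomposition_def by auto
  have dh\<mm>: "direct_sum UNIV \<hh> \<mm>" using assms(3) \<hh> by (simp add: reductive_decomposition_def)
  define y where "y = dproj G A H B X"
  obtain Xh Xm where X: "X = Xh + Xm" "Xh \<in> \<hh>" "Xm \<in> \<mm>"
    by (rule direct_sumE[OF dh\<mm> UNIV_I])
  obtain X1 X2 where Xm: "Xm = X1 + X2" "X1 \<in> \<mm>1" "X2 \<in> \<mm>2"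
    by (rule direct_sumE[OF assms(9) X(3)])
  \<comment> \<open>The projection kills \<open>\<hh>\<close>. \<open>geodesic_orbit_iff\<close>
    speaks of the projection of \<open>X\<close>, the norms in \<open>b\<close> of the projections
    of its components.\<close>
  have ym: "y = dproj G A H B Xm"
    using dproj_subalgebra[of Xh] X \<hh> by (simp add: y_def linear_add[OF linear_dproj])
  have comp\<mm>: "comp_along \<mm> \<hh> X = Xm" using comp_along_sum(2)[OF dh\<mm> X(2,3)] X(1) by simp
  have comp2: "comp_along \<mm>2 \<mm>1 Xm = X2" using comp_along_sum(2)[OF assms(9) Xm(2,3)] Xm(1) by simp
  have V: "dproj G A H B X1 \<in> V1 H" "dproj G A H B X2 \<in> V2 H"
    using Xm assms(12,13) by blast+
  have compV: "comp_along (V2 H) (V1 H) y = dproj G A H B X2"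
    using comp_along_sum(2)[OF ds V] by (simp add: ym Xm(1) linear_add[OF linear_dproj])
  \<comment> \<open>The hypothesis on the derived algebra makes every projected bracket an
    admissible direction for \<open>energy_derivative\<close>.\<close>
  have br: "dproj G A H B (lie_bracket G A X Z) \<in> V1 H" for Z
  proof -
    have "lie_bracket G A X Z \<in> derived_algebra G A"
      unfolding derived_algebra_def by (rule span_base) blast
    then obtain u v where uv: "lie_bracket G A X Z = u + v" "u \<in> \<hh>" "v \<in> \<mm>1"
      using assms(14) by blast
    then have "dproj G A H B (lie_bracket G A X Z) = dproj G A H B v"
      using dproj_subalgebra[of u] \<hh> by (simp add: linear_add[OF linear_dproj])
    then show ?thesis using uv(3) assms(12) by blast
  qed
  define b where "b = riem_norm g H (dproj G A H B X2) / riem_norm g H y"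
  define \<kappa> where "\<kappa> = (\<phi> b)\<^sup>2 - \<phi> b * deriv01 \<phi> b * b"
  have invF: "F (act_on a p) (dact G B a p v) = F p v"
    and invg: "riem_norm g (act_on a p) (dact G B a p v) = riem_norm g p v"
    if "a \<in> carrier G" "p \<in> lcosets\<^bsub>G\<^esub> H" for a p v
    using assms(5,6) that unfolding invariant_finsler_def invariant_riemannian_def riem_norm_def act_on_def by simp_all
  \<comment> \<open>One equivalence for both metrics: \<open>r\<close> is \<open>\<kappa>\<close>
    for \<open>F\<close> and 1 for \<open>g\<close>, and does not depend on \<open>Z\<close>.
    Smoothness of the orbit is carried along as a conjunct, since it belongs to
    \<open>geodesic\<close> and is the same condition for both metrics.\<close>
  have iff: "geodesic X\<^sub>M B N (\<lambda>t. c t <#\<^bsub>G\<^esub> H) \<longleftrightarrow>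
      smooth_curve X\<^sub>M B (\<lambda>t. c t <#\<^bsub>G\<^esub> H) \<and> y \<noteq> 0 \<and> (\<forall>Z. r * g H y (dproj G A H B (lie_bracket G A X Z)) = 0)"
    if N: "N = F \<and> r = \<kappa> \<or> N = riem_norm g \<and> r = 1" and c: "is_exp_curve G X\<^sub>G A X c" for N r c
  proof (cases "smooth_curve X\<^sub>M B (\<lambda>t. proj (c t))")
    case True
    have inv: "N (act_on a p) (dact G B a p v) = N p v" if "a \<in> carrier G" "p \<in> lcosets\<^bsub>G\<^esub> H" for a p v
      using N invF[OF that] invg[OF that] by auto
    have sm: "twice_differentiable_on (\<lambda>(x, v). chart_energy B k N x v) (snd k ` fst k \<times> - {0})" if "k \<in> B" for k
      using N finsler_energy_smooth[OF fin that] riemannian_energy_smooth[OF rie that] by auto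
    have "frechet_derivative (\<lambda>y. 1 / 2 * (N H y)\<^sup>2) (at y) (dproj G A H B (lie_bracket G A X Z))
        = r * g H y (dproj G A H B (lie_bracket G A X Z))" if "y \<noteq> 0" for Z
      using N energy_derivative[OF al that br] by (auto simp: compV b_def \<kappa>_def)
    with geodesic_orbit_iff[OF c True inv sm] True show ?thesis
      by (auto simp: proj_def y_def[symmetric])
  next
    case False
    then show ?thesis by (simp add: geodesic_def proj_def)
  qed
  have 1: "geodesic X\<^sub>M B F (\<lambda>t. c t <#\<^bsub>G\<^esub> H)"
    if "is_exp_curve G X\<^sub>G A X c" "geodesic X\<^sub>M B (riem_norm g) (\<lambda>t. c t <#\<^bsub>G\<^esub> H)" for c
    using iff[of F \<kappa> c] iff[of "riem_norm g" 1 c] that by simp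
  \<comment> \<open>Here the factor \<open>\<kappa>\<close> is cancelled; in both directions the
    same curve \<open>c\<close> is the witness.\<close>
  have 2: "geodesic X\<^sub>M B (riem_norm g) (\<lambda>t. c t <#\<^bsub>G\<^esub> H)"
    if "\<kappa> \<noteq> 0" "is_exp_curve G X\<^sub>G A X c" "geodesic X\<^sub>M B F (\<lambda>t. c t <#\<^bsub>G\<^esub> H)" for c
    using iff[of F \<kappa> c] iff[of "riem_norm g" 1 c] that by simp
  show ?thesis
    unfolding Let_def geodesic_vector_def \<hh>[symmetric] comp\<mm> comp2 ym[symmetric] b_def[symmetric] \<kappa>_def[symmetric]
    using 1 2 by blast
qed

end
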